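(* Let $K$ be a number field, $\mathfrak{p}$ a finite prime of $K$, $\tau\in\mathbb{N}^2$, and $F/K$ a field extension. Let $S_1,\dots,S_n\subseteq\mathcal{S}^\tau_{\mathfrak{p}}(F)$ be disjoint closed subsets, $x_1,\dots,x_n\in F$ and $z_1,\dots,z_n\in F^\times$. Assume that for any $\mathfrak{P}_i\in S_i$ and $\mathfrak{P}_j\in S_j$, if $w$ is the finest common coarsening of $v_{\mathfrak{P}_i}$ and $v_{\mathfrak{P}_j}$, then $w(x_i-x_j)\ge w(z_i)=w(z_j)$. Then there exists $x\in F$ with $v_{\mathfrak{Q}}(x-x_i)>v_{\mathfrak{Q}}(z_i)$ for all $\mathfrak{Q}\in S_i$, for $i=1,\dots,n$.
   Context: A $p$-valuation on a field $F$ is a Krull valuation $v$ with finite residue field of characteristic $p$ such that $(0,v(p)]$ in the value group is finite; a prime is an equivalence class of $p$-valuations, $v_{\mathfrak{P}}$ the representative whose value group has $\mathbb{Z}$ as smallest nontrivial convex subgroup. Primes of a number field are its finite places. Let $\tau=(e,f)$ and $t_{\mathfrak{p}}$ a uniformizer of $\mathfrak{p}$. A prime $\mathfrak{P}$ of $F$ above $\mathfrak{p}$ has relative type at most $\tau$ if $v_{\mathfrak{P}}(t_{\mathfrak{p}})\le e$ and its residue degree over $\mathfrak{p}$ divides $f$; $\mathcal{S}^\tau_{\mathfrak{p}}(F)$ is the set of these primes, equipped with the constructible topology, which has as basis the sets $\{\mathfrak{P}\in\mathcal{S}^\tau_{\mathfrak{p}}(F):v_{\mathfrak{P}}(a)\ge0\}$,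 $a\in F$, and their complements. *)

theory Defs
  imports
    "HOL-Analysis.Analysis"
    "HOL-Algebra.Embedded_Algebras"
    "HOL-Algebra.Elementary_Groups"
    "HOL-Algebra.Algebraic_Closure_Type"
begin

section \<open>Ordered abelian groups\<close>

text \<open>Value groups are carrier-based, since they vary with the valuation. The group operation
  is written multiplicatively as in HOL-Algebra, so that the \<open>0\<close> of the usual additive
  notation for value groups is \<open>\<one>\<close>.\<close>

record 'g ordered_group = "'g monoid" +
  gle :: "'g \<Rightarrow> 'g \<Rightarrow> bool"

definition ordered_abelian_group :: "'g ordered_group \<Rightarrow> bool" where
  "ordered_abelian_group G \<longleftrightarrow>
     comm_group G \<and>
     (\<forall>a\<in>carrier G. gle G a a) \<and>
     (\<forall>a\<in>carrier G. \<forall>b\<in>carrier G. gle G a b \<longrightarrow> gle G b a \<longrightarrow> a = b) \<and>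
     (\<forall>a\<in>carrier G. \<forall>b\<in>carrier G. \<forall>c\<in>carrier G. gle G a b \<longrightarrow> gle G b c \<longrightarrow> gle G a c) \<and>
     (\<forall>a\<in>carrier G. \<forall>b\<in>carrier G. gle G a b \<or> gle G b a) \<and>
     (\<forall>a\<in>carrier G. \<forall>b\<in>carrier G. \<forall>c\<in>carrier G.
        gle G a b \<longrightarrow> gle G (a \<otimes>\<^bsub>G\<^esub> c) (b \<otimes>\<^bsub>G\<^esub> c))"

definition convex_subgroup :: "'g set \<Rightarrow> 'g ordered_group \<Rightarrow> bool" where
  "convex_subgroup H G \<longleftrightarrow>
     subgroup H G \<and>
     (\<forall>a\<in>H. \<forall>b\<in>carrier G. gle G \<one>\<^bsub>G\<^esub> b \<longrightarrow> gle G b a \<longrightarrow> b \<in> H)"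

text \<open>\<open>j\<close> identifies the ordered group of integers with the smallest nontrivial convex
  subgroup of \<open>G\<close>. Such a \<open>j\<close> is unique: it maps \<open>1\<close> to the least positive element.\<close>

definition is_int_embedding :: "'g ordered_group \<Rightarrow> (int \<Rightarrow> 'g) \<Rightarrow> bool" where
  "is_int_embedding G j \<longleftrightarrow>
     j \<in> hom integer_group G \<and>
     (\<forall>m n. gle G (j m) (j n) \<longleftrightarrow> m \<le> n) \<and>
     convex_subgroup (range j) G \<and>
     (\<forall>H. convex_subgroup H G \<and> H \<noteq> {\<one>\<^bsub>G\<^esub>} \<longrightarrow> range j \<subseteq> H)"

definition int_embedding :: "'g ordered_group \<Rightarrow> int \<Rightarrow> 'g" where
  "int_embedding G = (THE j. is_int_embedding G j)"

text \<open>The group extended by \<open>\<infinity>\<close>, which is represented by \<open>None\<close>.\<close>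

fun ext_mult :: "'g ordered_group \<Rightarrow> 'g option \<Rightarrow> 'g option \<Rightarrow> 'g option" where
  "ext_mult G (Some a) (Some b) = Some (a \<otimes>\<^bsub>G\<^esub> b)"
| "ext_mult G _ _ = None"

fun ext_le :: "'g ordered_group \<Rightarrow> 'g option \<Rightarrow> 'g option \<Rightarrow> bool" where
  "ext_le G _ None = True"
| "ext_le G None (Some _) = False"
| "ext_le G (Some a) (Some b) = gle G a b"

definition ext_less :: "'g ordered_group \<Rightarrow> 'g option \<Rightarrow> 'g option \<Rightarrow> bool" where
  "ext_less G a b \<longleftrightarrow> ext_le G a b \<and> a \<noteq> b"


section \<open>Krull valuations\<close>

record ('a, 'g) valuation =
  value_group :: "'g ordered_group"
  val :: "'a \<Rightarrow> 'g option"

definition krull_valuation :: "('a::field, 'g) valuation \<Rightarrow> bool" where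
  "krull_valuation v \<longleftrightarrow>
     ordered_abelian_group (value_group v) \<and>
     val v ` (- {0}) = Some ` carrier (value_group v) \<and>
     val v 0 = None \<and>
     (\<forall>x y. val v (x * y) = ext_mult (value_group v) (val v x) (val v y)) \<and>
     (\<forall>x y. ext_le (value_group v) (val v x) (val v (x + y)) \<or>
            ext_le (value_group v) (val v y) (val v (x + y)))"

definition valuation_ring :: "('a, 'g) valuation \<Rightarrow> 'a set" where
  "valuation_ring v = {x. ext_le (value_group v) (Some \<one>\<^bsub>value_group v\<^esub>) (val v x)}"

definition maximal_ideal_of :: "('a, 'g) valuation \<Rightarrow> 'a set" where
  "maximal_ideal_of v = {x. ext_less (value_group v) (Some \<one>\<^bsub>value_group v\<^esub>) (val v x)}"

definition val_equiv :: "('a, 'g) valuation \<Rightarrow> ('a, 'h) valuation \<Rightarrow> bool" where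
  "val_equiv v w \<longleftrightarrow> valuation_ring v = valuation_ring w"

definition coarsening :: "('a, 'g) valuation \<Rightarrow> ('a, 'h) valuation \<Rightarrow> bool" where
  "coarsening w v \<longleftrightarrow> valuation_ring v \<subseteq> valuation_ring w"

definition restrict_val :: "('k::field \<Rightarrow> 'a::field) \<Rightarrow> ('a, 'g) valuation \<Rightarrow> ('k, 'g) valuation"
  where
  "restrict_val \<phi> v =
     \<lparr>value_group = (value_group v)\<lparr>carrier := {\<gamma>. \<exists>a. a \<noteq> 0 \<and> val v (\<phi> a) = Some \<gamma>}\<rparr>,
      val = val v \<circ> \<phi>\<rparr>"

definition valuation_ring_alg :: "('a::field, 'g) valuation \<Rightarrow> 'a ring" where
  "valuation_ring_alg v = ring_of_type_algebra\<lparr>carrier := valuation_ring v\<rparr>"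

definition residue_field :: "('a::field, 'g) valuation \<Rightarrow> 'a set ring" where
  "residue_field v = valuation_ring_alg v Quot maximal_ideal_of v"

definition residue_class :: "('a::field, 'g) valuation \<Rightarrow> 'a \<Rightarrow> 'a set" where
  "residue_class v a = maximal_ideal_of v +>\<^bsub>valuation_ring_alg v\<^esub> a"

definition has_characteristic :: "('r, 'm) ring_scheme \<Rightarrow> nat \<Rightarrow> bool" where
  "has_characteristic R p \<longleftrightarrow> (\<forall>m::nat. [m] \<cdot>\<^bsub>R\<^esub> \<one>\<^bsub>R\<^esub> = \<zero>\<^bsub>R\<^esub> \<longleftrightarrow> p dvd m)"

definition p_valuation :: "nat \<Rightarrow> ('a::field_char_0, 'g) valuation \<Rightarrow> bool" where
  "p_valuation p v \<longleftrightarrow>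
     Factorial_Ring.prime p \<and>
     krull_valuation v \<and>
     finite (carrier (residue_field v)) \<and>
     has_characteristic (residue_field v) p \<and>
     finite {\<gamma> \<in> carrier (value_group v).
               ext_less (value_group v) (Some \<one>\<^bsub>value_group v\<^esub>) (Some \<gamma>) \<and>
               ext_le (value_group v) (Some \<gamma>) (val v (of_nat p))}"


section \<open>Primes\<close>

text \<open>HOL cannot quantify over all value groups, so a universe for them has to be fixed.
  The type \<^typ>\<open>'a set\<close> suffices for valuations on \<^typ>\<open>'a\<close>: the value
  group is a quotient of the multiplicative group, so it can be realised by cosets.\<close>

lemma krull_valuation_universe:
  fixes v :: "('a::field, 'g) valuation"
  assumes "krull_valuation v"
  obtains w :: "('a, 'a set) valuation" where "krull_valuation w" "val_equiv v w"
proof -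
  define G where "G = value_group v"
  define h where "h = (\<lambda>\<gamma>. {x. val v x = Some \<gamma>})"
  define g where "g = the_inv_into (carrier G) h"
  define G' :: "'a set ordered_group" where
    "G' = \<lparr>carrier = h ` carrier G, mult = (\<lambda>A B. h (g A \<otimes>\<^bsub>G\<^esub> g B)), one = h \<one>\<^bsub>G\<^esub>,
           gle = (\<lambda>A B. gle G (g A) (g B))\<rparr>"
  define w :: "('a, 'a set) valuation" where
    "w = \<lparr>value_group = G', val = (\<lambda>x. map_option h (val v x))\<rparr>"
  have kv: "ordered_abelian_group G" "val v ` (- {0}) = Some ` carrier G" "val v 0 = None"
    "val v (x * y) = ext_mult G (val v x) (val v y)"
    "ext_le G (val v x) (val v (x + y)) \<or> ext_le G (val v y) (val v (x + y))" for x y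
    using assms unfolding krull_valuation_def G_def by simp_all
  have cg: "comm_group G"
    using kv(1) unfolding ordered_abelian_group_def by (rule conjunct1)
  interpret comm_group G by (rule cg)
  have h_ne: "h \<gamma> \<noteq> {}" if "\<gamma> \<in> carrier G" for \<gamma>
  proof -
    have "Some \<gamma> \<in> val v ` (- {0})" unfolding kv(2) using that by (rule imageI)
    then obtain x where "val v x = Some \<gamma>" by (metis imageE)
    then show ?thesis by (auto simp: h_def)
  qed
  have "inj_on h (carrier G)"
  proof (rule inj_onI)
    fix a b assume "a \<in> carrier G" "b \<in> carrier G" "h a = h b"
    moreover from this obtain x where "x \<in> h a" using h_ne[of a] by blast
    ultimately have "x \<in> h a" "x \<in> h b" by simp_all
    then show "a = b" by (simp add: h_def)
  qed
  then have gh: "g (h \<gamma>) = \<gamma>" if "\<gamma> \<in> carrier G" for \<gamma>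
    using that unfolding g_def by (simp add: the_inv_into_f_f)
  have val_cases: "val v x = None \<or> (\<exists>\<gamma>\<in>carrier G. val v x = Some \<gamma>)" for x
  proof (cases "x = 0")
    case False
    then have "val v x \<in> val v ` (- {0})" by simp
    then have "val v x \<in> Some ` carrier G" unfolding kv(2) .
    then show ?thesis by blast
  qed (simp add: kv(3))
  have ext_le': "ext_le G' (map_option h a) (map_option h b) \<longleftrightarrow> ext_le G a b"
    if "a = None \<or> (\<exists>\<gamma>\<in>carrier G. a = Some \<gamma>)" "b = None \<or> (\<exists>\<gamma>\<in>carrier G. b = Some \<gamma>)" for a b
    using that by (elim disjE bexE) (simp_all add: G'_def gh)
  have ext_mult': "ext_mult G' (map_option h a) (map_option h b) = map_option h (ext_mult G a b)"
    if "a = None \<or> (\<exists>\<gamma>\<in>carrier G. a = Some \<gamma>)" "b = None \<or> (\<exists>\<gamma>\<in>carrier G. b = Some \<gamma>)" for a b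
    using that by (elim disjE bexE) (simp_all add: G'_def gh)
  have "comm_group G'"
  proof (rule comm_groupI)
    fix A assume "A \<in> carrier G'"
    then obtain a where a: "a \<in> carrier G" "A = h a" by (auto simp: G'_def)
    then show "\<exists>B\<in>carrier G'. B \<otimes>\<^bsub>G'\<^esub> A = \<one>\<^bsub>G'\<^esub>"
      by (intro bexI[of _ "h (inv\<^bsub>G\<^esub> a)"]) (simp_all add: G'_def gh)
  next
    fix A B assume "A \<in> carrier G'" "B \<in> carrier G'"
    then show "A \<otimes>\<^bsub>G'\<^esub> B = B \<otimes>\<^bsub>G'\<^esub> A"
      by (auto simp: G'_def gh m_comm)
  qed (auto simp: G'_def gh m_assoc)
  note comm' = this
  have gle': "gle G' (h a) (h b) \<longleftrightarrow> gle G a b"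
    if "a \<in> carrier G" "b \<in> carrier G" for a b
    using that by (simp add: G'_def gh)
  have mult': "h a \<otimes>\<^bsub>G'\<^esub> h b = h (a \<otimes>\<^bsub>G\<^esub> b)"
    if "a \<in> carrier G" "b \<in> carrier G" for a b
    using that by (simp add: G'_def gh)
  have in_G': "\<exists>a\<in>carrier G. A = h a" if "A \<in> carrier G'" for A
    using that by (auto simp: G'_def)
  have ord: "a \<in> carrier G \<Longrightarrow> gle G a a"
    "\<lbrakk>a \<in> carrier G; b \<in> carrier G; gle G a b; gle G b a\<rbrakk> \<Longrightarrow> a = b"
    "\<lbrakk>a \<in> carrier G; b \<in> carrier G; c \<in> carrier G; gle G a b; gle G b c\<rbrakk> \<Longrightarrow> gle G a c"
    "\<lbrakk>a \<in> carrier G; b \<in> carrier G\<rbrakk> \<Longrightarrow> gle G a b \<or> gle G b a"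
    "\<lbrakk>a \<in> carrier G; b \<in> carrier G; c \<in> carrier G; gle G a b\<rbrakk> \<Longrightarrow>
       gle G (a \<otimes>\<^bsub>G\<^esub> c) (b \<otimes>\<^bsub>G\<^esub> c)" for a b c
    using kv(1) unfolding ordered_abelian_group_def by meson+
  have "ordered_abelian_group G'"
    unfolding ordered_abelian_group_def
  proof (intro conjI ballI impI comm')
    fix A assume "A \<in> carrier G'"
    then show "gle G' A A" using in_G' gle' ord(1) by metis
  next
    fix A B assume "A \<in> carrier G'" "B \<in> carrier G'" "gle G' A B" "gle G' B A"
    then show "A = B" using in_G' gle' ord(2) by metis
  next
    fix A B C assume "A \<in> carrier G'" "B \<in> carrier G'" "C \<in> carrier G'"
      "gle G' A B" "gle G' B C"
    then show "gle G' A C" using in_G' gle' ord(3) by metis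
  next
    fix A B assume "A \<in> carrier G'" "B \<in> carrier G'"
    then show "gle G' A B \<or> gle G' B A" using in_G' gle' ord(4) by metis
  next
    fix A B C assume *: "A \<in> carrier G'" "B \<in> carrier G'" "C \<in> carrier G'" "gle G' A B"
    then obtain a b c where "a \<in> carrier G" "b \<in> carrier G" "c \<in> carrier G"
      "A = h a" "B = h b" "C = h c" using in_G' by metis
    with * show "gle G' (A \<otimes>\<^bsub>G'\<^esub> C) (B \<otimes>\<^bsub>G'\<^esub> C)"
      by (simp add: mult' gle' ord(5))
  qed
  moreover have "(\<lambda>x. map_option h (val v x)) ` (- {0}) = Some ` carrier G'"
  proof -
    have "(\<lambda>x. map_option h (val v x)) ` (- {0}) = map_option h ` (val v ` (- {0}))"
      by (simp add: image_image)
    also have "\<dots> = Some ` carrier G'"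
      unfolding kv(2) by (simp add: G'_def image_image)
    finally show ?thesis .
  qed
  ultimately have "krull_valuation w"
    unfolding krull_valuation_def w_def
    by (simp only: valuation.simps kv(3,4) kv(5) option.map ext_le'[OF val_cases val_cases]
        ext_mult'[OF val_cases val_cases] simp_thms)
  moreover have "val_equiv v w"
  proof -
    have "ext_le G' (Some \<one>\<^bsub>G'\<^esub>) (map_option h (val v x)) \<longleftrightarrow> ext_le G (Some \<one>\<^bsub>G\<^esub>) (val v x)" for x
      using ext_le'[OF _ val_cases, of "Some \<one>\<^bsub>G\<^esub>" x] by (simp add: G'_def)
    then show ?thesis
      unfolding val_equiv_def valuation_ring_def w_def G_def[symmetric] by simp
  qed
  ultimately show thesis by (rule that)
qed

type_synonym 'a prime = "('a, 'a set) valuation set"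

definition p_valuations :: "('a::field_char_0, 'a set) valuation set" where
  "p_valuations = {v. \<exists>p. p_valuation p v}"

definition primes :: "'a::field_char_0 prime set" where
  "primes = p_valuations // {(v, w). v \<in> p_valuations \<and> w \<in> p_valuations \<and> val_equiv v w}"

text \<open>Representatives of the same prime differ only by an order isomorphism of value groups,
  so the choice made here is immaterial.\<close>

definition prime_val :: "'a::field_char_0 prime \<Rightarrow> ('a, 'a set) valuation" where
  "prime_val P = (SOME v. v \<in> P \<and> (\<exists>j. is_int_embedding (value_group v) j))"

definition val_ge0_at :: "'a::field_char_0 prime \<Rightarrow> 'a \<Rightarrow> bool" where
  "val_ge0_at P a \<longleftrightarrow>
     ext_le (value_group (prime_val P)) (Some \<one>\<^bsub>value_group (prime_val P)\<^esub>) (val (prime_val P) a)"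

definition uniformizer :: "'a::field_char_0 prime \<Rightarrow> 'a \<Rightarrow> bool" where
  "uniformizer P t \<longleftrightarrow>
     val (prime_val P) t = Some (int_embedding (value_group (prime_val P)) 1)"

definition finest_common_coarsening ::
  "('a::field, 'a set) valuation \<Rightarrow> ('a, 'a set) valuation \<Rightarrow> ('a, 'a set) valuation \<Rightarrow> bool" where
  "finest_common_coarsening w v1 v2 \<longleftrightarrow>
     krull_valuation w \<and> coarsening w v1 \<and> coarsening w v2 \<and>
     (\<forall>u :: ('a, 'a set) valuation.
        krull_valuation u \<and> coarsening u v1 \<and> coarsening u v2 \<longrightarrow> coarsening u w)"


section \<open>Field extensions and relative type\<close>

definition is_number_field :: "'k::field_char_0 itself \<Rightarrow> bool" where
  "is_number_field _ \<longleftrightarrow>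
     (\<exists>B. finite_dimensional_vector_space (\<lambda>(q::rat) (x::'k). of_rat q * x) B)"

abbreviation field_embedding :: "('k::field \<Rightarrow> 'f::field) \<Rightarrow> bool" where
  "field_embedding \<phi> \<equiv> \<phi> \<in> ring_hom ring_of_type_algebra ring_of_type_algebra"

text \<open>In the following, \<open>\<phi>\<close> is the embedding of the base field into the extension field.\<close>

definition lies_above ::
  "('k::field_char_0 \<Rightarrow> 'f::field_char_0) \<Rightarrow> 'f prime \<Rightarrow> 'k prime \<Rightarrow> bool" where
  "lies_above \<phi> \<PP> \<pp> \<longleftrightarrow> val_equiv (restrict_val \<phi> (prime_val \<PP>)) (prime_val \<pp>)"

definition residue_degree ::
  "('k::field_char_0 \<Rightarrow> 'f::field_char_0) \<Rightarrow> 'f prime \<Rightarrow> 'k prime \<Rightarrow> nat" where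
  "residue_degree \<phi> \<PP> \<pp> =
     ring.dim (residue_field (prime_val \<PP>))
       ((\<lambda>a. residue_class (prime_val \<PP>) (\<phi> a)) ` valuation_ring (prime_val \<pp>))
       (carrier (residue_field (prime_val \<PP>)))"

definition primes_of_type ::
  "('k::field_char_0 \<Rightarrow> 'f::field_char_0) \<Rightarrow> 'k prime \<Rightarrow> 'k \<Rightarrow> nat \<times> nat \<Rightarrow> 'f prime set" where
  "primes_of_type \<phi> \<pp> t \<tau> =
     {\<PP> \<in> primes. lies_above \<phi> \<PP> \<pp> \<and>
        ext_le (value_group (prime_val \<PP>)) (val (prime_val \<PP>) (\<phi> t))
          (Some (int_embedding (value_group (prime_val \<PP>)) (int (fst \<tau>)))) \<and>
        residue_degree \<phi> \<PP> \<pp> dvd snd \<tau>}"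

definition constructible_topology ::
  "('k::field_char_0 \<Rightarrow> 'f::field_char_0) \<Rightarrow> 'k prime \<Rightarrow> 'k \<Rightarrow> nat \<times> nat \<Rightarrow> 'f prime topology"
  where
  "constructible_topology \<phi> \<pp> t \<tau> =
     topology_generated_by
       (range (\<lambda>a. {\<PP> \<in> primes_of_type \<phi> \<pp> t \<tau>. val_ge0_at \<PP> a}) \<union>
        range (\<lambda>a. {\<PP> \<in> primes_of_type \<phi> \<pp> t \<tau>. \<not> val_ge0_at \<PP> a}))"

end

theory Submission
  imports Defs
begin

text \<open>
  A prime is determined by its valuation ring, and the rings of the primes of relative type at most
  \<open>(e, f)\<close> are the valuation rings \<open>R\<close> above the base ring with \<open>\<phi> t / a\<^sup>e\<^sup>+\<^sup>1 \<notin> R\<close> for every nonzero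
  nonunit \<open>a\<close> and \<open>a\<^sup>N - a\<close> a nonunit for every \<open>a \<in> R\<close>, where \<open>N = q\<^sup>f\<close> and \<open>q\<close> is the size of the base
  residue field. Each condition involves membership of finitely many elements only, so these rings
  form a closed, hence compact, subset of the space of all subsets of the field.

  The uniform exponent \<open>N\<close> makes \<open>u(a) = (1 + (a\<^sup>N - a)) / (1 + a (a\<^sup>N - a))\<close> have value
  \<open>max 0 (- v a)\<close> at all these primes simultaneously. Writing \<open>(x\<^sub>i - x\<^sub>j) / z\<^sub>j\<close>, which lies in the ring
  of the finest common coarsening, as a product of an integral element at \<open>P\<close> and one at \<open>Q\<close>, values
  of \<open>u\<close> give an everywhere integral \<open>s\<close> that is a unit at \<open>P\<close> and small at \<open>Q\<close>. Compactness turns this into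
  \<open>s\<^sub>i\<close> that are units on \<open>S\<^sub>i\<close> and small on the other sets, and \<open>(\<Sum> s\<^sub>i x\<^sub>i) / (\<Sum> s\<^sub>i)\<close> is the required
  element.
\<close>

section \<open>Valuation rings as subsets of a field\<close>

text \<open>Value groups may have large rank, so distinct primes of \<open>F\<close> can be
  dependent: their rings may lie in a common proper overring, and approximation needs a
  compatibility condition there. What survives of independence is incomparability. A proper
  inclusion between two of the rings would induce a nontrivial valuation on the residue field of the
  larger one, which a finite field does not admit. The notion of a p-valuation asks for a finite
  residue field and a finite interval of values, neither of which is visibly a closed condition.
  Bounding the type makes both uniform: a field with \<open>q^d\<close> elements satisfies
  \<open>x^(q^f) = x\<close> exactly when \<open>d\<close> divides \<open>f\<close>, and forbidding
  the division of \<open>\<phi> t\<close> by an \<open>(e+1)\<close>-st power of a nonunit already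
  forces a least positive value to exist. The weights \<open>s\<^sub>i\<close> do not add up to 1.
  On \<open>S\<^sub>j\<close> their sum is a unit, the \<open>j\<close>-th weight being a unit and
  the others small, so dividing by it costs nothing.\<close>

definition val_ring :: "'a::field set \<Rightarrow> bool" where
  "val_ring R \<longleftrightarrow> 1 \<in> R \<and> (\<forall>x\<in>R. \<forall>y\<in>R. x - y \<in> R \<and> x * y \<in> R) \<and> (\<forall>x. x \<in> R \<or> inverse x \<in> R)"

text \<open>The maximal ideal of \<open>R\<close>. Zero has to be listed, because
  \<open>inverse 0 = 0\<close> lies in \<open>R\<close>.\<close>

definition nonunits :: "'a::field set \<Rightarrow> 'a set" where
  "nonunits R = {x \<in> R. x = 0 \<or> inverse x \<notin> R}"

lemma val_ring_simps:
  assumes "val_ring R"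
  shows val_ring_1: "1 \<in> R" and val_ring_0: "0 \<in> R"
    and val_ring_diff: "\<And>x y. x \<in> R \<Longrightarrow> y \<in> R \<Longrightarrow> x - y \<in> R"
    and val_ring_mult: "\<And>x y. x \<in> R \<Longrightarrow> y \<in> R \<Longrightarrow> x * y \<in> R"
    and val_ring_uminus: "\<And>x. x \<in> R \<Longrightarrow> - x \<in> R"
    and val_ring_add: "\<And>x y. x \<in> R \<Longrightarrow> y \<in> R \<Longrightarrow> x + y \<in> R"
    and val_ring_inverse: "\<And>x. x \<notin> R \<Longrightarrow> inverse x \<in> R"
proof -
  show 1: "1 \<in> R" and d: "\<And>x y. x \<in> R \<Longrightarrow> y \<in> R \<Longrightarrow> x - y \<in> R"
    and "\<And>x y. x \<in> R \<Longrightarrow> y \<in> R \<Longrightarrow> x * y \<in> R"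
    and "\<And>x. x \<notin> R \<Longrightarrow> inverse x \<in> R"
    using assms by (auto simp: val_ring_def)
  show 0: "0 \<in> R" using d[OF 1 1] by simp
  show m: "- x \<in> R" if "x \<in> R" for x using d[OF 0 that] by simp
  show "x + y \<in> R" if "x \<in> R" "y \<in> R" for x y using d[OF that(1) m[OF that(2)]] by simp
qed

lemma val_ring_power: "val_ring R \<Longrightarrow> x \<in> R \<Longrightarrow> x ^ n \<in> R"
  by (induction n) (simp_all add: val_ring_1 val_ring_mult)

lemma nonunits_subset: "x \<in> nonunits R \<Longrightarrow> x \<in> R"
  by (simp add: nonunits_def)

lemma nonunits_0: "val_ring R \<Longrightarrow> 0 \<in> nonunits R"
  by (simp add: nonunits_def val_ring_0)

lemma one_notin_nonunits: "val_ring R \<Longrightarrow> 1 \<notin> nonunits R"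
  by (simp add: nonunits_def val_ring_1)

lemma nonunits_mult:
  assumes R: "val_ring R" and "x \<in> R" "y \<in> nonunits R"
  shows "x * y \<in> nonunits R" "y * x \<in> nonunits R"
proof -
  have "inverse y = x * inverse (x * y)" if "x \<noteq> 0"
    using that by (simp add: field_simps)
  then have "inverse (x * y) \<notin> R" if "x \<noteq> 0" "y \<noteq> 0"
    using assms val_ring_mult[OF R \<open>x \<in> R\<close>] that by (metis (mono_tags, lifting) mem_Collect_eq nonunits_def)
  then show "x * y \<in> nonunits R"
    using assms by (auto simp: nonunits_def val_ring_mult)
  then show "y * x \<in> nonunits R" by (simp add: mult.commute)
qed

text \<open>Of two nonzero elements one divides the other in \<open>R\<close>, so the sum is a
  multiple of one of the two nonunits.\<close>

lemma nonunits_add: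
  assumes R: "val_ring R" and x: "x \<in> nonunits R" and y: "y \<in> nonunits R"
  shows "x + y \<in> nonunits R"
proof -
  have *: "u + w \<in> nonunits R" if u: "u \<in> nonunits R" and "w \<noteq> 0" "u / w \<in> R" "w \<in> nonunits R" for u w
  proof -
    have "u + w = (u / w + 1) * w" using that by (simp add: field_simps)
    then show ?thesis using that by (simp add: nonunits_mult R val_ring_add val_ring_1)
  qed
  show ?thesis
  proof (cases "x = 0 \<or> y = 0")
    case False
    then consider "x / y \<in> R" | "y / x \<in> R"
      using val_ring_inverse[OF R, of "x / y"] by auto
    then show ?thesis
      using *[of x y] *[of y x] False x y by cases (auto simp: add.commute)
  qed (use x y in auto)
qed

lemma nonunits_uminus: "val_ring R \<Longrightarrow> x \<in> nonunits R \<Longrightarrow> - x \<in> nonunits R"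
  by (auto simp: nonunits_def val_ring_uminus dest: val_ring_uminus)

lemma nonunits_diff: "val_ring R \<Longrightarrow> x \<in> nonunits R \<Longrightarrow> y \<in> nonunits R \<Longrightarrow> x - y \<in> nonunits R"
  using nonunits_add[of R x "- y"] nonunits_uminus[of R y] by simp

lemma unit_add_nonunit:
  assumes "val_ring R" "x \<in> R" "x \<notin> nonunits R" "y \<in> nonunits R"
  shows "x + y \<in> R" "x + y \<notin> nonunits R"
  using assms val_ring_add[of R x y] nonunits_subset[of y R] nonunits_diff[of R "x + y" y] by auto

lemma unit_mult:
  assumes "val_ring R" "x \<in> R" "x \<notin> nonunits R" "y \<in> R" "y \<notin> nonunits R"
  shows "x * y \<notin> nonunits R"
  using assms val_ring_mult[of R "inverse x" "inverse y"] by (auto simp: nonunits_def)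

lemma nonunits_power:
  assumes "val_ring R" "x \<in> nonunits R" "n > 0"
  shows "x ^ n \<in> nonunits R"
  using assms nonunits_mult(2)[OF assms(1) val_ring_power[of R x "n - 1"] assms(2)]
  by (cases n) (auto simp: nonunits_subset)

lemma inverse_nonunit: "val_ring R \<Longrightarrow> x \<notin> R \<Longrightarrow> inverse x \<in> nonunits R"
  by (auto simp: nonunits_def val_ring_inverse val_ring_0)

lemma unit_inverse: "x \<in> R \<Longrightarrow> x \<notin> nonunits R \<Longrightarrow> inverse x \<in> R"
  by (auto simp: nonunits_def)

lemma unit_inverse_nonunits: "x \<in> R \<Longrightarrow> x \<notin> nonunits R \<Longrightarrow> inverse x \<notin> nonunits R"
  by (auto simp: nonunits_def)

lemma val_ring_prod:
  assumes "val_ring R" "\<And>i. i \<in> I \<Longrightarrow> g i \<in> R"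
  shows "prod g I \<in> R"
  using assms(2) by (induction I rule: infinite_finite_induct) (auto simp: assms(1) val_ring_1 val_ring_mult)

lemma unit_prod:
  assumes "val_ring R" "\<And>i. i \<in> I \<Longrightarrow> g i \<in> R" "\<And>i. i \<in> I \<Longrightarrow> g i \<notin> nonunits R"
  shows "prod g I \<notin> nonunits R"
  using assms(2,3)
  by (induction I rule: infinite_finite_induct)
     (auto simp: assms(1) one_notin_nonunits unit_mult val_ring_prod)

lemma nonunits_sum:
  assumes "val_ring R" "\<And>i. i \<in> I \<Longrightarrow> g i \<in> nonunits R"
  shows "sum g I \<in> nonunits R"
  using assms(2) by (induction I rule: infinite_finite_induct) (auto simp: assms(1) nonunits_0 nonunits_add)

text \<open>One good factor is enough, the others being integral. The multiplier \<open>c\<close> is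
  carried along because smallness is needed of the product itself, with \<open>c = 1\<close>, and of
  the product times a fixed coefficient.\<close>

lemma nonunits_prod_dvd:
  assumes "val_ring R" "finite I" "\<And>i. i \<in> I \<Longrightarrow> g i \<in> R" "k \<in> I" "c * g k \<in> nonunits R"
  shows "c * prod g I \<in> nonunits R"
proof -
  have "c * prod g I = prod g (I - {k}) * (c * g k)"
    using assms by (simp add: prod.remove[of I k] mult_ac)
  moreover have "prod g (I - {k}) \<in> R" using assms by (intro val_ring_prod) auto
  ultimately show ?thesis
    using nonunits_mult(1)[OF assms(1) _ assms(5)] by metis
qed

text \<open>The compositum of two valuation rings consists of plain products, no sums are needed.\<close>

definition ring_prod :: "'a::field set \<Rightarrow> 'a set \<Rightarrow> 'a set" where
  "ring_prod R R' = {a * b |a b. a \<in> R \<and> b \<in> R'}"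

lemma ring_prod_memI: "a \<in> R \<Longrightarrow> b \<in> R' \<Longrightarrow> a * b \<in> ring_prod R R'"
  by (auto simp: ring_prod_def)

lemma ring_prod_commute: "ring_prod R R' = ring_prod R' R"
proof -
  have "ring_prod A B \<subseteq> ring_prod B A" for A B :: "'a set"
  proof
    fix x assume "x \<in> ring_prod A B"
    then obtain a b where "x = a * b" "a \<in> A" "b \<in> B" by (auto simp: ring_prod_def)
    then show "x \<in> ring_prod B A" using ring_prod_memI[of b B a A] by (simp add: mult.commute)
  qed
  then show ?thesis by blast
qed

text \<open>The point is that a sum \<open>a * b + a' * b'\<close> is again a single product. If
  \<open>r = a' / a\<close> lies in \<open>R\<close>, factor out \<open>a\<close>; in the remaining
  \<open>b + r * b'\<close> either \<open>r\<close> lies in \<open>R'\<close>, or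
  \<open>inverse r\<close> does and \<open>r\<close> moves to the first factor.\<close>

lemma val_ring_ring_prod:
  assumes R: "val_ring R" and R': "val_ring R'"
  shows "val_ring (ring_prod R R')"
proof -
  have *: "a * (b + r * b') \<in> ring_prod R R'" if "a \<in> R" "r \<in> R" "b \<in> R'" "b' \<in> R'" for a r b b'
  proof (cases "r \<in> R'")
    case True
    then show ?thesis using that by (intro ring_prod_memI) (simp_all add: R' val_ring_add val_ring_mult)
  next
    case False
    then have "r \<noteq> 0" using val_ring_0[OF R'] by auto
    then have "a * (b + r * b') = (a * r) * (b * inverse r + b')" by (simp add: field_simps)
    moreover have "a * r \<in> R" "b * inverse r + b' \<in> R'"
      using that False by (simp_all add: R R' val_ring_mult val_ring_add val_ring_inverse)
    ultimately show ?thesis by (simp only: ring_prod_memI)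
  qed
  have add: "a * b + a' * b' \<in> ring_prod R R'" if "a \<in> R" "a' \<in> R" "b \<in> R'" "b' \<in> R'" for a a' b b'
  proof (cases "a = 0 \<or> a' = 0")
    case False
    then consider "a' / a \<in> R" | "a / a' \<in> R"
      using val_ring_inverse[OF R, of "a / a'"] by auto
    then show ?thesis
      using *[of a "a' / a" b b'] *[of a' "a / a'" b' b] False that
      by cases (auto simp: field_simps)
  qed (use that in \<open>auto intro: ring_prod_memI\<close>)
  show ?thesis unfolding val_ring_def
  proof (intro conjI ballI allI)
    show "1 \<in> ring_prod R R'" using ring_prod_memI[of 1 R 1 R'] by (simp add: R R' val_ring_1)
    fix x y assume "x \<in> ring_prod R R'" "y \<in> ring_prod R R'"
    then obtain a b a' b' where ab: "x = a * b" "a \<in> R" "b \<in> R'" "y = a' * b'" "a' \<in> R" "b' \<in> R'"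
      by (auto simp: ring_prod_def)
    then show "x - y \<in> ring_prod R R'"
      using add[of a "- a'" b b'] by (simp add: R val_ring_uminus)
    have "x * y = (a * a') * (b * b')" using ab by (simp add: mult_ac)
    moreover have "a * a' \<in> R" "b * b' \<in> R'" using ab by (simp_all add: R R' val_ring_mult)
    ultimately show "x * y \<in> ring_prod R R'" by (simp only: ring_prod_memI)
  next
    fix x
    show "x \<in> ring_prod R R' \<or> inverse x \<in> ring_prod R R'"
      using ring_prod_memI[of x R 1 R'] ring_prod_memI[of "inverse x" R 1 R']
        val_ring_inverse[OF R, of x] val_ring_1[OF R'] by auto
  qed
qed

lemma ring_prod_upper:
  assumes "val_ring R" "val_ring R'"
  shows "R \<subseteq> ring_prod R R'" "R' \<subseteq> ring_prod R R'"
  using assms ring_prod_memI[of _ R 1 R'] ring_prod_memI[of 1 R _ R'] by (auto simp: val_ring_1)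

lemma ring_prod_least:
  assumes "val_ring T" "R \<subseteq> T" "R' \<subseteq> T"
  shows "ring_prod R R' \<subseteq> T"
proof
  fix x assume "x \<in> ring_prod R R'"
  then obtain a b where "x = a * b" "a \<in> T" "b \<in> T" using assms(2,3) by (auto simp: ring_prod_def)
  then show "x \<in> T" using val_ring_mult[OF assms(1)] by simp
qed

text \<open>If the residue field of \<open>R\<close> satisfies \<open>a\<^sup>N = a\<close>, then \<open>denominator N a\<close> has value
  \<open>max 0 (- v a)\<close>.\<close>

definition denominator :: "nat \<Rightarrow> 'a::field \<Rightarrow> 'a" where
  "denominator N a = (1 + (a ^ N - a)) / (1 + a * (a ^ N - a))"

definition residues_fixed :: "nat \<Rightarrow> 'a::field set \<Rightarrow> bool" where
  "residues_fixed N R \<longleftrightarrow> (\<forall>a\<in>R. a ^ N - a \<in> nonunits R)"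

text \<open>Here \<open>a ^ N - a\<close> is a nonunit, so numerator and denominator of the fraction
  are both 1 plus a nonunit.\<close>

lemma denominator_unit:
  assumes R: "val_ring R" "residues_fixed N R" and a: "a \<in> R"
  shows "denominator N a \<in> R" "denominator N a \<notin> nonunits R"
proof -
  let ?n = "1 + (a ^ N - a)" and ?d = "1 + a * (a ^ N - a)"
  have "a ^ N - a \<in> nonunits R" "a * (a ^ N - a) \<in> nonunits R"
    using assms by (auto simp: residues_fixed_def intro: nonunits_mult)
  then have n: "?n \<in> R" "?n \<notin> nonunits R" and d: "?d \<in> R" "?d \<notin> nonunits R"
    using unit_add_nonunit[OF R(1) val_ring_1[OF R(1)] one_notin_nonunits[OF R(1)]] by blast+
  have "denominator N a = ?n * inverse ?d" by (simp add: denominator_def divide_inverse)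
  then show "denominator N a \<in> R" "denominator N a \<notin> nonunits R"
    using n d by (simp_all add: val_ring_mult[OF R(1)] unit_mult[OF R(1)] unit_inverse unit_inverse_nonunits)
qed

text \<open>Outside \<open>R\<close> the highest powers of \<open>a\<close> dominate: numerator and
  denominator behave like \<open>a ^ N\<close> and \<open>a ^ (N + 1)\<close>. Substituting
  \<open>b = inverse a\<close> leaves factors that are 1 plus nonunits, where
  \<open>N \<ge> 2\<close> keeps the exponent \<open>N - 1\<close> of \<open>b\<close>
  positive.\<close>

lemma denominator_mult_unit:
  assumes R: "val_ring R" and N: "N \<ge> 2" and a: "a \<notin> R"
  shows "denominator N a * a \<in> R" "denominator N a * a \<notin> nonunits R"
proof -
  define b where "b = inverse a"
  have b: "b \<in> nonunits R" "b \<noteq> 0"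
    using inverse_nonunit[OF R a] a val_ring_0[OF R] by (auto simp: b_def)
  obtain m where m: "N = Suc (Suc m)" using N by (metis add_2_eq_Suc le_Suc_ex)
  let ?n = "1 + (b ^ N - b ^ (N - 1))" and ?d = "1 + (b ^ (N + 1) - b ^ (N - 1))"
  have "b ^ N - b ^ (N - 1) \<in> nonunits R" "b ^ (N + 1) - b ^ (N - 1) \<in> nonunits R"
    by (rule nonunits_diff[OF R]; rule nonunits_power[OF R b(1)]; use N in simp)+
  then have n: "?n \<in> R" "?n \<notin> nonunits R" and d: "?d \<in> R" "?d \<notin> nonunits R"
    using unit_add_nonunit[OF R val_ring_1[OF R] one_notin_nonunits[OF R]] by blast+
  have d0: "?d \<noteq> 0" using d nonunits_0[OF R] by metis
  have a_b: "a = inverse b" by (simp add: b_def)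
  have 1: "1 + (a ^ N - a) = ?n / b ^ N"
    using b(2) unfolding a_b m by (simp add: field_simps)
  have 2: "1 + a * (a ^ N - a) = ?d / b ^ (N + 1)"
    using b(2) unfolding a_b m by (simp add: field_simps)
  have "denominator N a * a = ?n * inverse ?d"
    unfolding denominator_def 1 2 unfolding a_b using b(2) d0
    by (simp add: divide_inverse power_add nonzero_inverse_mult_distrib mult_ac)
  then show "denominator N a * a \<in> R" "denominator N a * a \<notin> nonunits R"
    using n d by (simp_all add: val_ring_mult[OF R] unit_mult[OF R] unit_inverse unit_inverse_nonunits)
qed

lemma denominator_nonunit:
  assumes R: "val_ring R" and N: "N \<ge> 2" and a: "a \<notin> R"
  shows "denominator N a \<in> nonunits R"
proof -
  have "a \<noteq> 0" using a val_ring_0[OF R] by auto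
  then have "denominator N a = (denominator N a * a) * inverse a" by simp
  then show ?thesis
    using nonunits_mult(1)[OF R denominator_mult_unit(1)[OF assms] inverse_nonunit[OF R a]] by metis
qed

text \<open>With both cases for \<open>a\<close> covered, the single field element
  \<open>denominator N a\<close> is integral in all rings with exponent \<open>N\<close> at
  once.\<close>

lemma denominator_in:
  assumes "val_ring R" "residues_fixed N R" "N \<ge> 2"
  shows "denominator N a \<in> R" "denominator N a * a \<in> R"
  using assms denominator_unit(1)[of R N a] denominator_nonunit[of R N a]
    denominator_mult_unit(1)[of R N a] by (auto intro: nonunits_subset val_ring_mult)

text \<open>If the inclusion were proper, \<open>R\<close> would induce a proper valuation ring of
  the residue field of \<open>R'\<close>, whereas \<open>x^N = x\<close> makes every residue
  integral over that ring. The computation lifts this argument to the field.\<close>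

lemma residues_fixed_incomparable:
  assumes R: "val_ring R" and R': "val_ring R'" "residues_fixed N R'" and N: "N \<ge> 2"
    and sub: "R \<subseteq> R'"
  shows "R = R'"
proof (rule ccontr)
  assume "R \<noteq> R'"
  then obtain b where b: "b \<in> R'" "b \<notin> R" using sub by auto
  have "b ^ N - b \<in> nonunits R'" using R' b by (auto simp: residues_fixed_def)
  moreover have "x \<in> R" if "x \<in> nonunits R'" for x
    using that sub val_ring_inverse[OF R, of x] val_ring_0[OF R] by (auto simp: nonunits_def)
  ultimately have *: "b ^ N - b \<in> R" by blast
  \<comment> \<open>Multiplying \<open>b ^ N - b\<close> by \<open>c ^ N\<close> gives
    \<open>1 - c ^ (N - 1)\<close>. Both this and \<open>c ^ (N - 1)\<close> are nonunits of
    \<open>R\<close>, yet they add up to 1.\<close>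
  define c where "c = inverse b"
  have c: "c \<in> nonunits R" "b = inverse c" "c \<noteq> 0"
    using inverse_nonunit[OF R b(2)] b(2) val_ring_0[OF R] by (auto simp: c_def)
  obtain m where m: "N = Suc (Suc m)" using N by (metis add_2_eq_Suc le_Suc_ex)
  have "c ^ N * (b ^ N - b) \<in> nonunits R" using c N * by (intro nonunits_mult(2) nonunits_power) (auto simp: R)
  moreover have "c ^ N * (b ^ N - b) = 1 - c ^ (N - 1)"
    using c(3) unfolding c(2) m by (simp add: field_simps)
  moreover have "c ^ (N - 1) \<in> nonunits R" using c N by (intro nonunits_power) (auto simp: R)
  ultimately have "1 \<in> nonunits R" using nonunits_add[OF R, of "1 - c ^ (N - 1)" "c ^ (N - 1)"] by simp
  then show False using one_notin_nonunits[OF R] by simp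
qed

text \<open>Write \<open>c = a * a'\<close> with \<open>a\<close> in \<open>R\<close> and
  \<open>a'\<close> in \<open>R'\<close>. The factor \<open>denominator N a\<close> is a unit in
  \<open>R\<close> and cancels \<open>a\<close> in \<open>R'\<close>. A second factor
  \<open>denominator N b\<close>, with \<open>b\<close> in \<open>R\<close> but not in
  \<open>R'\<close>, is a unit in \<open>R\<close> and a nonunit in \<open>R'\<close>;
  incomparability provides \<open>b\<close>.\<close>

lemma separate_two_val_rings:
  assumes R: "val_ring R" "residues_fixed N R" and R': "val_ring R'" "residues_fixed N R'"
    and N: "N \<ge> 2" and ne: "R \<noteq> R'" and c: "c \<in> ring_prod R R'"
  obtains s where "s \<in> R" "s \<notin> nonunits R" "s \<in> nonunits R'" "c * s \<in> nonunits R'"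
    "\<And>Q. val_ring Q \<Longrightarrow> residues_fixed N Q \<Longrightarrow> s \<in> Q"
proof -
  obtain a a' where a: "a \<in> R" "a' \<in> R'" "c = a * a'" using c by (auto simp: ring_prod_def)
  obtain b where b: "b \<in> R" "b \<notin> R'"
    using residues_fixed_incomparable[OF R(1) R' N] ne by auto
  let ?s = "denominator N b * denominator N a"
  have *: "denominator N b \<in> nonunits R'" using denominator_nonunit[OF R'(1) N b(2)] .
  have "c * ?s = (a' * (denominator N a * a)) * denominator N b" using a by (simp add: mult_ac)
  then have "c * ?s \<in> nonunits R'"
    using nonunits_mult(1)[OF R'(1) _ *] a val_ring_mult[OF R'(1)] denominator_in[OF R' N] by metis
  moreover have "?s \<in> nonunits R'" using nonunits_mult(2)[OF R'(1) _ *] denominator_in[OF R' N] by metis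
  moreover have "?s \<in> R" "?s \<notin> nonunits R"
    using denominator_unit[OF R] a b by (simp_all add: unit_mult R val_ring_mult)
  moreover have "?s \<in> Q" if "val_ring Q" "residues_fixed N Q" for Q
    using that N by (simp add: denominator_in val_ring_mult)
  ultimately show thesis using that by blast
qed

text \<open>The expression acts as a disjunction of integral elements \<open>g i\<close>: it is
  small where all of them are small, and congruent to 1 where one of them is. It replaces the
  product when a single good \<open>g i\<close> should suffice for being a unit.\<close>

lemma one_minus_prod_nonunits:
  assumes R: "val_ring R" and "\<And>i. i \<in> I \<Longrightarrow> g i \<in> nonunits R" "\<And>i. i \<in> I \<Longrightarrow> c * g i \<in> nonunits R"
  shows "1 - (\<Prod>i\<in>I. 1 - g i) \<in> nonunits R \<and> c * (1 - (\<Prod>i\<in>I. 1 - g i)) \<in> nonunits R"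
  using assms(2,3)
proof (induction I rule: infinite_finite_induct)
  case (insert k I)
  let ?p = "\<Prod>i\<in>I. 1 - g i"
  have "1 - (\<Prod>i\<in>insert k I. 1 - g i) = (1 - ?p) + g k - g k * (1 - ?p)"
    "c * (1 - (\<Prod>i\<in>insert k I. 1 - g i)) = c * (1 - ?p) + c * g k - g k * (c * (1 - ?p))"
    using insert.hyps by (simp_all add: algebra_simps)
  moreover have "g k \<in> nonunits R" "c * g k \<in> nonunits R" "1 - ?p \<in> nonunits R" "c * (1 - ?p) \<in> nonunits R"
    using insert by simp_all
  ultimately show ?case
    using R by (simp only: nonunits_diff nonunits_add nonunits_mult(1) nonunits_subset simp_thms)
qed (auto simp: R nonunits_0)

section \<open>Weak approximation on a compact space of valuation rings\<close>

locale val_ring_space =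
  fixes T :: "'p topology" and ring_at :: "'p \<Rightarrow> 'a::field set" and N :: nat
  assumes N: "N \<ge> 2"
    and val_ring_at: "\<And>P. P \<in> topspace T \<Longrightarrow> val_ring (ring_at P)"
    and fixed_at: "\<And>P. P \<in> topspace T \<Longrightarrow> residues_fixed N (ring_at P)"
    and inj_ring_at: "inj_on ring_at (topspace T)"
    and open_in: "\<And>a. openin T {P \<in> topspace T. a \<in> ring_at P}"
    and open_notin: "\<And>a. openin T {P \<in> topspace T. a \<notin> ring_at P}"
begin

lemma open_unit: "openin T {P \<in> topspace T. a \<in> ring_at P \<and> a \<notin> nonunits (ring_at P)}"
proof (cases "a = 0")
  case True
  then have "{P \<in> topspace T. a \<in> ring_at P \<and> a \<notin> nonunits (ring_at P)} = {}"
    using val_ring_at nonunits_0 by blast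
  then show ?thesis by (simp only: openin_empty)
next
  case False
  then have "{P \<in> topspace T. a \<in> ring_at P \<and> a \<notin> nonunits (ring_at P)} =
    {P \<in> topspace T. a \<in> ring_at P} \<inter> {P \<in> topspace T. inverse a \<in> ring_at P}"
    by (auto simp: nonunits_def)
  then show ?thesis by (simp add: openin_Int open_in)
qed

lemma open_nonunit: "openin T {P \<in> topspace T. a \<in> nonunits (ring_at P)}"
proof (cases "a = 0")
  case True
  then have "{P \<in> topspace T. a \<in> nonunits (ring_at P)} = topspace T"
    using val_ring_at nonunits_0 by blast
  then show ?thesis by (simp only: openin_topspace)
next
  case False
  then have "{P \<in> topspace T. a \<in> nonunits (ring_at P)} =
    {P \<in> topspace T. a \<in> ring_at P} \<inter> {P \<in> topspace T. inverse a \<notin> ring_at P}"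
    by (auto simp: nonunits_def)
  then show ?thesis by (simp add: openin_Int open_in open_notin)
qed

definition integral :: "'a \<Rightarrow> bool" where
  "integral s \<longleftrightarrow> (\<forall>P\<in>topspace T. s \<in> ring_at P)"

definition unit_on :: "'a \<Rightarrow> 'p set \<Rightarrow> bool" where
  "unit_on s A \<longleftrightarrow> (\<forall>P\<in>A. s \<notin> nonunits (ring_at P))"

text \<open>Both requirements come from the final weighted mean: smallness of \<open>s\<close> keeps
  the sum of the weights a unit, and smallness of \<open>c * s\<close> absorbs the coefficient
  \<open>c = (x i - x j) / z j\<close>.\<close>

definition small_on :: "'a \<Rightarrow> 'a \<Rightarrow> 'p set \<Rightarrow> bool" where
  "small_on s c B \<longleftrightarrow> (\<forall>Q\<in>B. s \<in> nonunits (ring_at Q) \<and> c * s \<in> nonunits (ring_at Q))"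

text \<open>Each \<open>Q\<close> in \<open>B\<close> has its own separating element, which stays
  small on a neighbourhood of \<open>Q\<close>. By compactness finitely many of them serve all of
  \<open>B\<close>; their product is small as soon as one factor is, and it remains a unit at
  \<open>P\<close>.\<close>

lemma separate_point_compact:
  assumes P: "P \<in> topspace T" and B: "compactin T B" "P \<notin> B"
    and c: "\<And>Q. Q \<in> B \<Longrightarrow> c \<in> ring_prod (ring_at P) (ring_at Q)"
  obtains s where "integral s" "unit_on s {P}" "small_on s c B"
proof -
  have BT: "B \<subseteq> topspace T" using B by (simp add: compactin_def)
  have "\<exists>s. integral s \<and> unit_on s {P} \<and> small_on s c {Q}" if Q: "Q \<in> B" for Q
  proof -
    have QT: "Q \<in> topspace T" using BT Q by auto
    have "ring_at P \<noteq> ring_at Q" using inj_onD[OF inj_ring_at _ P QT] Q B(2) by auto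
    from separate_two_val_rings[OF val_ring_at[OF P] fixed_at[OF P] val_ring_at[OF QT] fixed_at[OF QT] N this c[OF Q]]
    obtain s where "s \<notin> nonunits (ring_at P)" "s \<in> nonunits (ring_at Q)" "c * s \<in> nonunits (ring_at Q)"
      "\<And>Q. val_ring Q \<Longrightarrow> residues_fixed N Q \<Longrightarrow> s \<in> Q" by blast
    then show ?thesis
      by (intro exI[of _ s]) (simp add: integral_def unit_on_def small_on_def val_ring_at fixed_at)
  qed
  then obtain \<sigma> where \<sigma>: "\<And>Q. Q \<in> B \<Longrightarrow> integral (\<sigma> Q) \<and> unit_on (\<sigma> Q) {P} \<and> small_on (\<sigma> Q) c {Q}"
    by metis
  let ?U = "\<lambda>s. {Q \<in> topspace T. s \<in> nonunits (ring_at Q)} \<inter> {Q \<in> topspace T. c * s \<in> nonunits (ring_at Q)}"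
  have "\<exists>\<F>. finite \<F> \<and> \<F> \<subseteq> (?U \<circ> \<sigma>) ` B \<and> B \<subseteq> \<Union>\<F>"
  proof (rule compactinD[OF B(1)])
    show "openin T U" if "U \<in> (?U \<circ> \<sigma>) ` B" for U using that by (auto intro!: openin_Int open_nonunit)
    show "B \<subseteq> \<Union> ((?U \<circ> \<sigma>) ` B)" using \<sigma> BT by (fastforce simp: small_on_def)
  qed
  then obtain \<F> where "finite \<F>" "\<F> \<subseteq> (?U \<circ> \<sigma>) ` B" and cover: "B \<subseteq> \<Union>\<F>" by blast
  from finite_subset_image[OF this(1,2)]
  obtain F where F': "F \<subseteq> B" "finite F" "\<F> = (?U \<circ> \<sigma>) ` F" by blast
  note F = F'(2,1) cover[unfolded F'(3)]
  have "integral (prod \<sigma> F)"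
    using \<sigma> F unfolding integral_def by (auto intro!: val_ring_prod val_ring_at)
  moreover have "prod \<sigma> F \<notin> nonunits (ring_at P)"
    by (rule unit_prod[OF val_ring_at[OF P]]) (use \<sigma> F P in \<open>auto simp: unit_on_def integral_def\<close>)
  then have "unit_on (prod \<sigma> F) {P}" by (simp add: unit_on_def)
  moreover have "small_on (prod \<sigma> F) c B"
    unfolding small_on_def
  proof (intro ballI)
    fix Q assume Q: "Q \<in> B"
    then obtain k where k: "k \<in> F" "\<sigma> k \<in> nonunits (ring_at Q)" "c * \<sigma> k \<in> nonunits (ring_at Q)" using F by auto
    have "\<sigma> i \<in> ring_at Q" if "i \<in> F" for i using \<sigma> that F Q BT by (auto simp: integral_def)
    then have "d * \<sigma> k \<in> nonunits (ring_at Q) \<Longrightarrow> d * prod \<sigma> F \<in> nonunits (ring_at Q)" for d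
      using nonunits_prod_dvd[of "ring_at Q" F \<sigma> k d] val_ring_at F k Q BT by auto
    from this[of 1] this[of c] show "prod \<sigma> F \<in> nonunits (ring_at Q) \<and> c * prod \<sigma> F \<in> nonunits (ring_at Q)"
      using k by auto
  qed
  ultimately show thesis using that by blast
qed

text \<open>Compactness is now used in the other argument. A product would not do, since the element
  belonging to one point of \<open>A\<close> need not be a unit at the others; what is needed is a
  unit wherever at least one of finitely many elements is a unit.\<close>

lemma separate_compact_compact:
  assumes A: "compactin T A" and B: "compactin T B" "A \<inter> B = {}"
    and c: "\<And>P Q. P \<in> A \<Longrightarrow> Q \<in> B \<Longrightarrow> c \<in> ring_prod (ring_at P) (ring_at Q)"
  obtains s where "integral s" "unit_on s A" "small_on s c B"
proof -
  have AT: "A \<subseteq> topspace T" and BT: "B \<subseteq> topspace T" using A B by (simp_all add: compactin_def)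
  have "\<exists>s. integral s \<and> unit_on s {P} \<and> small_on s c B" if P: "P \<in> A" for P
    using separate_point_compact[OF _ B(1) _ c[OF P]] P AT B by (metis disjoint_iff subsetD)
  then obtain \<sigma> where \<sigma>: "\<And>P. P \<in> A \<Longrightarrow> integral (\<sigma> P) \<and> unit_on (\<sigma> P) {P} \<and> small_on (\<sigma> P) c B"
    by metis
  let ?U = "\<lambda>s. {P \<in> topspace T. s \<in> ring_at P \<and> s \<notin> nonunits (ring_at P)}"
  have "\<exists>\<F>. finite \<F> \<and> \<F> \<subseteq> (?U \<circ> \<sigma>) ` A \<and> A \<subseteq> \<Union>\<F>"
  proof (rule compactinD[OF A])
    show "openin T U" if "U \<in> (?U \<circ> \<sigma>) ` A" for U using that by (auto intro!: open_unit)
    show "A \<subseteq> \<Union> ((?U \<circ> \<sigma>) ` A)" using \<sigma> AT by (fastforce simp: unit_on_def integral_def)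
  qed
  then obtain \<F> where "finite \<F>" "\<F> \<subseteq> (?U \<circ> \<sigma>) ` A" and cover: "A \<subseteq> \<Union>\<F>" by blast
  from finite_subset_image[OF this(1,2)]
  obtain F where F': "F \<subseteq> A" "finite F" "\<F> = (?U \<circ> \<sigma>) ` F" by blast
  note F = F'(2,1) cover[unfolded F'(3)]
  \<comment> \<open>A unit to the power \<open>N - 1\<close> is congruent to 1, so one unit factor makes the product small.\<close>
  define g where "g P = \<sigma> P ^ (N - 1)" for P
  define s where "s = 1 - (\<Prod>P\<in>F. 1 - g P)"
  have g_in: "g P \<in> ring_at Q" if "P \<in> F" "Q \<in> topspace T" for P Q
    using \<sigma> F that by (auto simp: g_def integral_def intro!: val_ring_power val_ring_at)
  have "integral s"
    using g_in unfolding integral_def s_def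
    by (auto intro!: val_ring_diff val_ring_prod val_ring_at simp: val_ring_1 val_ring_at)
  moreover have "unit_on s A"
    unfolding unit_on_def
  proof (intro ballI)
    fix P assume P: "P \<in> A"
    then have PT: "P \<in> topspace T" using AT by auto
    note R = val_ring_at[OF PT]
    obtain k where k: "k \<in> F" "\<sigma> k \<in> ring_at P" "\<sigma> k \<notin> nonunits (ring_at P)" using F P by auto
    have k0: "\<sigma> k \<noteq> 0" using k nonunits_0[OF R] by auto
    obtain m where m: "N = Suc m" using N by (cases N) auto
    \<comment> \<open>Since \<open>g k\<close> is \<open>\<sigma> k ^ (N - 1)\<close>, the exponent
      \<open>N\<close> of the residue field appears after multiplying by the unit
      \<open>\<sigma> k\<close>. The factor \<open>1 *\<close> matches the multiplier in
      \<open>nonunits_prod_dvd\<close>.\<close>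
    have "1 * (1 - g k) = - (inverse (\<sigma> k) * (\<sigma> k ^ N - \<sigma> k))"
      using k0 by (simp add: g_def m field_simps)
    also have "\<dots> \<in> nonunits (ring_at P)"
      using fixed_at[OF PT] k R by (auto simp: residues_fixed_def intro!: nonunits_uminus nonunits_mult(1) unit_inverse)
    finally have "(\<Prod>P\<in>F. 1 - g P) \<in> nonunits (ring_at P)"
      using nonunits_prod_dvd[OF R F(1) _ k(1), of "\<lambda>P. 1 - g P" 1] g_in PT R
      by (simp add: val_ring_diff val_ring_1)
    then show "s \<notin> nonunits (ring_at P)"
      unfolding s_def using nonunits_add[OF R] one_notin_nonunits[OF R] by (metis diff_add_cancel)
  qed
  moreover have "small_on s c B"
    unfolding small_on_def s_def
  proof (intro ballI one_minus_prod_nonunits)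
    fix Q i assume Q: "Q \<in> B" and "i \<in> F"
    then have QT: "Q \<in> topspace T" using BT by auto
    note R = val_ring_at[OF QT]
    \<comment> \<open>As \<open>N - 1\<close> is positive, \<open>g i\<close> still contains a
      factor \<open>\<sigma> i\<close>, and this is what makes \<open>c * g i\<close> small.\<close>
    obtain m where m: "N = Suc (Suc m)" using N by (metis add_2_eq_Suc le_Suc_ex)
    have sm: "\<sigma> i \<in> nonunits (ring_at Q)" "c * \<sigma> i \<in> nonunits (ring_at Q)" "\<sigma> i \<in> ring_at Q"
      using \<sigma> F Q \<open>i \<in> F\<close> by (auto simp: small_on_def nonunits_subset)
    have "g i = \<sigma> i ^ m * \<sigma> i" "c * g i = \<sigma> i ^ m * (c * \<sigma> i)" by (simp_all add: g_def m)
    moreover have "\<sigma> i ^ m \<in> ring_at Q" using sm R by (simp add: val_ring_power)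
    ultimately show "g i \<in> nonunits (ring_at Q)" "c * g i \<in> nonunits (ring_at Q)"
      using sm R by (simp_all only: nonunits_mult(1))
  qed (use BT val_ring_at in auto)
  ultimately show thesis using that by blast
qed

theorem approximation:
  fixes x z :: "'i \<Rightarrow> 'a"
  assumes I: "finite I" and S: "\<And>i. i \<in> I \<Longrightarrow> compactin T (S i)" and dis: "disjoint_family_on S I"
    and c: "\<And>i j P Q. i \<in> I \<Longrightarrow> j \<in> I \<Longrightarrow> P \<in> S i \<Longrightarrow> Q \<in> S j \<Longrightarrow>
      (x i - x j) / z j \<in> ring_prod (ring_at P) (ring_at Q)"
  obtains y where "\<And>i P. i \<in> I \<Longrightarrow> P \<in> S i \<Longrightarrow> (y - x i) / z i \<in> nonunits (ring_at P)"
proof -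
  have ST: "S i \<subseteq> topspace T" if "i \<in> I" for i using S[OF that] by (simp add: compactin_def)
  have "\<exists>s. integral s \<and> unit_on s (S i) \<and> small_on s ((x i - x j) / z j) (S j)"
    if ij: "i \<in> I" "j \<in> I" "i \<noteq> j" for i j
    using separate_compact_compact[OF S[OF ij(1)] S[OF ij(2)] _ c[OF ij(1,2)]] ij dis
    by (metis disjoint_family_on_def)
  then obtain \<sigma> where \<sigma>: "\<And>i j. i \<in> I \<Longrightarrow> j \<in> I \<Longrightarrow> i \<noteq> j \<Longrightarrow>
      integral (\<sigma> i j) \<and> unit_on (\<sigma> i j) (S i) \<and> small_on (\<sigma> i j) ((x i - x j) / z j) (S j)"
    by metis
  define s where "s i = prod (\<sigma> i) (I - {i})" for i
  define y where "y = (\<Sum>i\<in>I. s i * x i) / sum s I"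
  have "(y - x j) / z j \<in> nonunits (ring_at P)" if j: "j \<in> I" and P: "P \<in> S j" for j P
  proof -
    have PT: "P \<in> topspace T" using ST j P by auto
    note R = val_ring_at[OF PT]
    have \<sigma>_in: "\<sigma> i k \<in> ring_at P" if "i \<in> I" "k \<in> I - {i}" for i k
      using \<sigma>[of i k] that PT by (auto simp: integral_def)
    have \<sigma>_unit: "\<sigma> j k \<notin> nonunits (ring_at P)" if "k \<in> I - {j}" for k
      using \<sigma>[OF j, of k] that P by (auto simp: unit_on_def)
    have s_j: "s j \<in> ring_at P" unfolding s_def by (rule val_ring_prod[OF R \<sigma>_in[OF j]])
    have s_j': "s j \<notin> nonunits (ring_at P)" unfolding s_def by (rule unit_prod[OF R \<sigma>_in[OF j] \<sigma>_unit])
    have small: "d * s i \<in> nonunits (ring_at P)"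
      if "d * \<sigma> i j \<in> nonunits (ring_at P)" "i \<in> I" "i \<noteq> j" for d i
      unfolding s_def by (rule nonunits_prod_dvd[OF R _ \<sigma>_in[OF that(2)]]) (use that I j in auto)
    have s_i: "s i \<in> nonunits (ring_at P)" "(x i - x j) / z j * s i \<in> nonunits (ring_at P)"
      if "i \<in> I" "i \<noteq> j" for i
      using small[of 1 i] small[of "(x i - x j) / z j" i] \<sigma>[OF that(1) j that(2)] that P
      by (simp_all add: small_on_def)
    have sum_eq: "sum s I = s j + sum s (I - {j})" using I j by (rule sum.remove)
    have "sum s (I - {j}) \<in> nonunits (ring_at P)" using s_i by (intro nonunits_sum[OF R]) auto
    then have sum_unit: "sum s I \<in> ring_at P" "sum s I \<notin> nonunits (ring_at P)"
      unfolding sum_eq using unit_add_nonunit[OF R s_j s_j'] by auto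
    then have sum0: "sum s I \<noteq> 0" using nonunits_0[OF R] by metis
    \<comment> \<open>Subtracting \<open>x j\<close> from the weighted mean leaves the weighted mean
      of the differences \<open>x i - x j\<close>. Its term for \<open>i = j\<close> vanishes, so it
      does no harm that \<open>s j\<close> is not small.\<close>
    have "(\<Sum>i\<in>I. (x i - x j) / z j * s i) = (\<Sum>i\<in>I. s i * x i - s i * x j) / z j"
      unfolding sum_divide_distrib by (intro sum.cong) (auto simp: algebra_simps)
    also have "\<dots> = (y - x j) / z j * sum s I"
      using sum0 by (simp add: y_def sum_subtractf flip: sum_distrib_right) (simp add: field_simps)
    finally have eq: "(y - x j) / z j = inverse (sum s I) * (\<Sum>i\<in>I. (x i - x j) / z j * s i)"
      using sum0 by simp
    have "(x i - x j) / z j * s i \<in> nonunits (ring_at P)" if "i \<in> I" for i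
      using s_i(2)[OF that] nonunits_0[OF R] by (cases "i = j") auto
    then show ?thesis
      unfolding eq by (rule nonunits_mult(1)[OF R unit_inverse[OF sum_unit] nonunits_sum[OF R]])
  qed
  then show thesis using that by blast
qed

end

section \<open>Krull valuations and their rings\<close>

locale krull =
  fixes v :: "('a::field, 'g) valuation" and G (structure)
  assumes krull: "krull_valuation v"
  defines "G \<equiv> value_group v"
begin

lemma ordered_group: "ordered_abelian_group G"
  using krull by (simp add: krull_valuation_def G_def)

sublocale comm_group G
  using ordered_group by (simp add: ordered_abelian_group_def)

lemma gle_refl: "a \<in> carrier G \<Longrightarrow> gle G a a"
  and gle_antisym: "\<lbrakk>a \<in> carrier G; b \<in> carrier G; gle G a b; gle G b a\<rbrakk> \<Longrightarrow> a = b"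
  and gle_trans: "\<lbrakk>a \<in> carrier G; b \<in> carrier G; c \<in> carrier G; gle G a b; gle G b c\<rbrakk> \<Longrightarrow> gle G a c"
  and gle_total: "\<lbrakk>a \<in> carrier G; b \<in> carrier G\<rbrakk> \<Longrightarrow> gle G a b \<or> gle G b a"
  and gle_mult: "\<lbrakk>a \<in> carrier G; b \<in> carrier G; c \<in> carrier G; gle G a b\<rbrakk> \<Longrightarrow> gle G (a \<otimes> c) (b \<otimes> c)"
  using ordered_group unfolding ordered_abelian_group_def by meson+

lemma gle_mult_iff:
  assumes "a \<in> carrier G" "b \<in> carrier G" "c \<in> carrier G"
  shows "gle G (a \<otimes> c) (b \<otimes> c) \<longleftrightarrow> gle G a b"
  using gle_mult[of "a \<otimes> c" "b \<otimes> c" "inv c"] gle_mult[of a b c] assms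
  by (auto simp: m_assoc)

lemma val_0: "val v 0 = None"
  and val_mult: "val v (x * y) = ext_mult G (val v x) (val v y)"
  and val_add: "ext_le G (val v x) (val v (x + y)) \<or> ext_le G (val v y) (val v (x + y))"
  and val_image: "val v ` (- {0}) = Some ` carrier G"
  using krull by (simp_all add: krull_valuation_def G_def)

lemma val_nonzero:
  assumes "x \<noteq> 0"
  obtains \<gamma> where "\<gamma> \<in> carrier G" "val v x = Some \<gamma>"
proof -
  have "val v x \<in> val v ` (- {0})" using assms by simp
  then show thesis unfolding val_image using that by auto
qed

lemma val_surj:
  assumes "\<gamma> \<in> carrier G"
  obtains x where "x \<noteq> 0" "val v x = Some \<gamma>"
proof -
  have "Some \<gamma> \<in> val v ` (- {0})" unfolding val_image using assms by simp
  then obtain x where "x \<in> - {0}" "Some \<gamma> = val v x" by (rule imageE)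
  then show thesis using that[of x] by simp
qed

lemma val_1: "val v 1 = Some \<one>"
proof -
  obtain \<gamma> where g: "\<gamma> \<in> carrier G" "val v 1 = Some \<gamma>" using val_nonzero[of 1] by auto
  have "val v 1 = ext_mult G (val v 1) (val v 1)" using val_mult[of 1 1] by simp
  then have "\<gamma> = \<gamma> \<otimes> \<gamma>" using g by simp
  then show ?thesis using g by (metis l_cancel_one')
qed

abbreviation "R \<equiv> valuation_ring v"

lemma in_R: "x \<in> R \<longleftrightarrow> ext_le G (Some \<one>) (val v x)"
  by (simp add: valuation_ring_def G_def)

text \<open>Turns comparisons of values into membership in the valuation ring, which is how value
  groups are eliminated later. The case \<open>b = 0\<close> fits in, since infinity is the largest
  value and \<open>0 \<in> R\<close>.\<close>

lemma ext_le_val: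
  assumes "a \<noteq> 0"
  shows "ext_le G (val v a) (val v b) \<longleftrightarrow> b / a \<in> R"
proof (cases "b = 0")
  case False
  obtain \<alpha> where \<alpha>: "\<alpha> \<in> carrier G" "val v a = Some \<alpha>" using val_nonzero[OF assms] .
  obtain \<gamma> where \<gamma>: "\<gamma> \<in> carrier G" "val v (b / a) = Some \<gamma>" using val_nonzero[of "b / a"] False assms by auto
  have "val v b = Some (\<gamma> \<otimes> \<alpha>)" using val_mult[of "b / a" a] assms \<alpha> \<gamma> by simp
  then show ?thesis
    using \<alpha> \<gamma> gle_mult_iff[of \<one> \<gamma> \<alpha>] by (simp add: in_R)
qed (simp add: in_R val_0)

lemma val_ring_R: "val_ring R"
proof -
  have [simp]: "0 \<in> R" "1 \<in> R" using ext_le_val[of 1 1] val_1 gle_refl by (simp_all add: in_R val_0)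
  have mult: "x * y \<in> R" if "x \<in> R" "y \<in> R" for x y
  proof (cases "x = 0 \<or> y = 0")
    case False
    obtain \<alpha> \<beta> where \<alpha>: "\<alpha> \<in> carrier G" "val v x = Some \<alpha>" and \<beta>: "\<beta> \<in> carrier G" "val v y = Some \<beta>"
      using val_nonzero False by metis
    have "gle G \<one> \<alpha>" "gle G \<one> \<beta>" using that \<alpha> \<beta> by (simp_all add: in_R)
    then have "gle G \<one> (\<alpha> \<otimes> \<beta>)"
      using gle_mult[of \<one> \<alpha> \<beta>] gle_trans[of \<one> \<beta> "\<alpha> \<otimes> \<beta>"] \<alpha> \<beta> by simp
    then show ?thesis using \<alpha> \<beta> by (simp add: in_R val_mult)
  qed auto
  have inv: "x \<in> R \<or> inverse x \<in> R" for x
  proof (cases "x = 0")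
    case False
    obtain \<alpha> where \<alpha>: "\<alpha> \<in> carrier G" "val v x = Some \<alpha>" using val_nonzero[OF False] .
    have "inverse x \<in> R \<longleftrightarrow> gle G \<alpha> \<one>" using ext_le_val[OF False, of 1] \<alpha> val_1 by (simp add: divide_inverse)
    moreover have "x \<in> R \<longleftrightarrow> gle G \<one> \<alpha>" using \<alpha> by (simp add: in_R)
    ultimately show ?thesis using gle_total[of \<one> \<alpha>] \<alpha> by simp
  qed auto
  \<comment> \<open>\<open>- 1\<close> is its own inverse, so either alternative of
    \<open>inv\<close> puts it into \<open>R\<close>.\<close>
  have m1: "- 1 \<in> R"
    using inv[of "- 1"] by simp
  have add: "x + y \<in> R" if "x \<in> R" "y \<in> R" for x y
  proof (cases "x = 0 \<or> y = 0")
    case False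
    have 1: "(x + y) / x \<in> R \<or> (x + y) / y \<in> R"
      using val_add[of x y] ext_le_val[of x "x + y"] ext_le_val[of y "x + y"] False by simp
    have "x + y = (x + y) / x * x" "x + y = (x + y) / y * y" using False by simp_all
    then show ?thesis using 1 mult that by metis
  qed (use that in auto)
  have "x - y \<in> R" if "x \<in> R" "y \<in> R" for x y
    using add[OF that(1) mult[OF m1 that(2)]] by simp
  then show ?thesis using mult inv by (simp add: val_ring_def)
qed

lemma val_eq_iff:
  assumes "a \<noteq> 0" "b \<noteq> 0"
  shows "val v a = val v b \<longleftrightarrow> b / a \<in> R \<and> a / b \<in> R"
proof -
  obtain \<alpha> \<beta> where \<alpha>: "\<alpha> \<in> carrier G" "val v a = Some \<alpha>" and \<beta>: "\<beta> \<in> carrier G" "val v b = Some \<beta>"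
    using val_nonzero assms by metis
  have "\<alpha> = \<beta> \<longleftrightarrow> gle G \<alpha> \<beta> \<and> gle G \<beta> \<alpha>" using gle_antisym gle_refl \<alpha> \<beta> by metis
  then show ?thesis using ext_le_val[of a b] ext_le_val[of b a] assms \<alpha> \<beta> by simp
qed

lemma ext_less_val:
  assumes "a \<noteq> 0"
  shows "ext_less G (val v a) (val v b) \<longleftrightarrow> b / a \<in> nonunits R"
proof (cases "b = 0")
  case True
  obtain \<alpha> where "val v a = Some \<alpha>" using val_nonzero[OF assms] by blast
  with True show ?thesis
    using val_0 nonunits_0[OF val_ring_R] by (simp add: ext_less_def)
next
  case False
  then show ?thesis
    using ext_le_val[OF assms] val_eq_iff[OF assms False] assms
    by (auto simp: ext_less_def nonunits_def)
qed

lemma maximal_ideal_of_eq: "maximal_ideal_of v = nonunits R"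
  using ext_less_val[of 1] val_1 by (auto simp: maximal_ideal_of_def G_def)

lemma val_power:
  assumes "val v a = Some \<alpha>" "\<alpha> \<in> carrier G"
  shows "val v (a ^ n) = Some (\<alpha> [^] n)"
  by (induction n) (simp_all add: val_1 val_mult assms power_Suc2 del: power_Suc)

end

text \<open>The value group is the multiplicative group of the field modulo the units
  \<open>U\<close>, ordered by divisibility, and \<open>h x\<close> is the coset of
  \<open>x\<close>. The operations on cosets are defined through representatives \<open>r\<close>;
  \<open>mult_h\<close> and \<open>gle_h\<close> show that their choice does not matter.\<close>

lemma ex_valuation_of_val_ring:
  fixes R :: "'a::field set"
  assumes R: "val_ring R"
  obtains v :: "('a, 'a set) valuation" where "krull_valuation v" "valuation_ring v = R"
proof -
  define U where "U = {u \<in> R. u \<notin> nonunits R}"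
  define h where "h x = {y. y / x \<in> U}" for x
  have U0: "u \<noteq> 0" if "u \<in> U" for u using that nonunits_0[OF R] by (auto simp: U_def)
  have Umult: "u * w \<in> U" if "u \<in> U" "w \<in> U" for u w
    using that by (simp add: U_def val_ring_mult[OF R] unit_mult[OF R])
  have Uinv: "inverse u \<in> U" if "u \<in> U" for u
    using that by (simp add: U_def unit_inverse unit_inverse_nonunits)
  have U1: "1 \<in> U" by (simp add: U_def val_ring_1[OF R] one_notin_nonunits[OF R])
  have UR: "u \<in> R" if "u \<in> U" for u using that by (simp add: U_def)
  have U_iff: "u \<in> U \<longleftrightarrow> u \<in> R \<and> inverse u \<in> R" if "u \<noteq> 0" for u
    using that by (auto simp: U_def nonunits_def)
  have mem: "x \<in> h x" if "x \<noteq> 0" for x using that U1 by (simp add: h_def)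
  have sub: "h x \<subseteq> h y" if "x \<in> h y" "x \<noteq> 0" for x y
  proof
    fix w assume "w \<in> h x"
    then have "w / x * (x / y) \<in> U" using that by (intro Umult) (simp_all add: h_def)
    then show "w \<in> h y" using that by (simp add: h_def)
  qed
  have sym: "y \<in> h x" if "x \<in> h y" for x y
    using Uinv[of "x / y"] that by (simp add: h_def)
  have h_eq: "h x = h y \<longleftrightarrow> y / x \<in> U" if "x \<noteq> 0" "y \<noteq> 0" for x y
  proof
    assume "h x = h y"
    then have "y \<in> h x" using mem[OF \<open>y \<noteq> 0\<close>] by simp
    then show "y / x \<in> U" by (simp add: h_def)
  next
    assume "y / x \<in> U"
    then have "y \<in> h x" "x \<in> h y" using sym[of y x] by (simp_all add: h_def)
    then show "h x = h y" using sub that by blast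
  qed
  define r where "r A = (SOME x. x \<in> A)" for A :: "'a set"
  have r: "r (h x) \<noteq> 0" "h (r (h x)) = h x" "r (h x) / x \<in> U" if "x \<noteq> 0" for x
  proof -
    have m: "r (h x) \<in> h x" unfolding r_def by (rule someI[of _ x]) (rule mem[OF that])
    then show "r (h x) / x \<in> U" by (simp add: h_def)
    then show "r (h x) \<noteq> 0" using U0 by fastforce
    then show "h (r (h x)) = h x" using sub[OF m] sub[OF sym[OF m] that] by blast
  qed
  define G :: "'a set ordered_group" where
    "G = \<lparr>carrier = h ` (- {0}), mult = (\<lambda>A B. h (r A * r B)), one = h 1,
          gle = (\<lambda>A B. r B / r A \<in> R)\<rparr>"
  define v :: "('a, 'a set) valuation" where
    "v = \<lparr>value_group = G, val = (\<lambda>x. if x = 0 then None else Some (h x))\<rparr>"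
  have mult_h: "h x \<otimes>\<^bsub>G\<^esub> h y = h (x * y)" if "x \<noteq> 0" "y \<noteq> 0" for x y
  proof -
    have "(r (h x) / x) * (r (h y) / y) \<in> U" using r(3)[OF that(1)] r(3)[OF that(2)] by (rule Umult)
    then have "r (h x) * r (h y) / (x * y) \<in> U" by simp
    then show ?thesis using that r h_eq[of "x * y" "r (h x) * r (h y)"] by (simp add: G_def)
  qed
  have gle_h: "gle G (h x) (h y) \<longleftrightarrow> y / x \<in> R" if xy: "x \<noteq> 0" "y \<noteq> 0" for x y
  proof -
    let ?a = "r (h y) / y" and ?b = "inverse (r (h x) / x)"
    have ab: "?a \<in> U" "?b \<in> U" using r(3)[OF xy(1)] r(3)[OF xy(2)] Uinv by blast+
    have "r (h y) / r (h x) = y / x * (?a * ?b)" "y / x = r (h y) / r (h x) * (inverse ?a * inverse ?b)"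
      using that r[OF xy(1)] r[OF xy(2)] by (simp_all add: field_simps)
    moreover have "?a * ?b \<in> R" "inverse ?a * inverse ?b \<in> R"
      using ab Umult Uinv UR by blast+
    ultimately have "r (h y) / r (h x) \<in> R \<longleftrightarrow> y / x \<in> R"
      using val_ring_mult[OF R] by metis
    then show ?thesis by (simp add: G_def)
  qed
  have carr: "A \<in> carrier G \<longleftrightarrow> (\<exists>x. x \<noteq> 0 \<and> A = h x)" for A
    by (auto simp: G_def)
  have one: "\<one>\<^bsub>G\<^esub> = h 1" by (simp add: G_def)
  have c1: "comm_group G"
  proof (rule comm_groupI)
    fix A assume "A \<in> carrier G"
    then obtain x where "x \<noteq> 0" "A = h x" by (auto simp: carr)
    then show "\<exists>B\<in>carrier G. B \<otimes>\<^bsub>G\<^esub> A = \<one>\<^bsub>G\<^esub>"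
      by (intro bexI[of _ "h (inverse x)"]) (auto simp: carr mult_h one intro!: exI[of _ "inverse x"])
  next
    fix A B C assume "A \<in> carrier G" "B \<in> carrier G" "C \<in> carrier G"
    then obtain x y z where "x \<noteq> 0" "A = h x" "y \<noteq> 0" "B = h y" "z \<noteq> 0" "C = h z" by (auto simp: carr)
    then show "A \<otimes>\<^bsub>G\<^esub> B \<otimes>\<^bsub>G\<^esub> C = A \<otimes>\<^bsub>G\<^esub> (B \<otimes>\<^bsub>G\<^esub> C)"
      by (simp add: mult_h mult.assoc)
  next
    fix A B assume "A \<in> carrier G" "B \<in> carrier G"
    then obtain x y where xy: "x \<noteq> 0" "A = h x" "y \<noteq> 0" "B = h y" by (auto simp: carr)
    then show "A \<otimes>\<^bsub>G\<^esub> B = B \<otimes>\<^bsub>G\<^esub> A"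
      by (simp add: mult_h mult.commute)
    have "x * y \<noteq> 0" using xy by simp
    then show "A \<otimes>\<^bsub>G\<^esub> B \<in> carrier G"
      unfolding carr using xy mult_h by blast
  next
    fix A assume "A \<in> carrier G"
    then obtain x where "x \<noteq> 0" "A = h x" by (auto simp: carr)
    then show "\<one>\<^bsub>G\<^esub> \<otimes>\<^bsub>G\<^esub> A = A" by (simp add: one mult_h)
  next
    show "\<one>\<^bsub>G\<^esub> \<in> carrier G" unfolding carr one by (intro exI[of _ 1]) simp
  qed
  have c2: "gle G A A" if "A \<in> carrier G" for A
    using that gle_h val_ring_1[OF R] by (force simp: carr)
  have c3: "A = B" if "A \<in> carrier G" "B \<in> carrier G" "gle G A B" "gle G B A" for A B
  proof -
    from that obtain x y where "x \<noteq> 0" "A = h x" "y \<noteq> 0" "B = h y" by (auto simp: carr)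
    then show ?thesis using that h_eq gle_h by (simp add: U_iff)
  qed
  have c4: "gle G A C"
    if "A \<in> carrier G" "B \<in> carrier G" "C \<in> carrier G" "gle G A B" "gle G B C" for A B C
  proof -
    from that obtain x y z where "x \<noteq> 0" "A = h x" "y \<noteq> 0" "B = h y" "z \<noteq> 0" "C = h z" by (auto simp: carr)
    then show ?thesis using that val_ring_mult[OF R, of "y / x" "z / y"] by (simp add: gle_h)
  qed
  have c5: "gle G A B \<or> gle G B A" if "A \<in> carrier G" "B \<in> carrier G" for A B
  proof -
    from that obtain x y where "x \<noteq> 0" "A = h x" "y \<noteq> 0" "B = h y" by (auto simp: carr)
    then show ?thesis using val_ring_inverse[OF R, of "y / x"] by (auto simp: gle_h)
  qed
  have c6: "gle G (A \<otimes>\<^bsub>G\<^esub> C) (B \<otimes>\<^bsub>G\<^esub> C)"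
    if "A \<in> carrier G" "B \<in> carrier G" "C \<in> carrier G" "gle G A B" for A B C
  proof -
    from that obtain x y z where "x \<noteq> 0" "A = h x" "y \<noteq> 0" "B = h y" "z \<noteq> 0" "C = h z" by (auto simp: carr)
    then show ?thesis using that by (simp add: gle_h mult_h)
  qed
  have oag: "ordered_abelian_group G"
    unfolding ordered_abelian_group_def
    by (intro conjI ballI impI c1; (rule c2 c3 c5 c6 | rule c4); assumption)
  have le: "ext_le G (val v x) (val v y) \<longleftrightarrow> y / x \<in> R" if "x \<noteq> 0" for x y
    using that gle_h val_ring_0[OF R] by (simp add: v_def)
  have add: "ext_le G (val v x) (val v (x + y)) \<or> ext_le G (val v y) (val v (x + y))" for x y
  proof (cases "x = 0 \<or> y = 0")
    case False
    then have "(x + y) / x = 1 + y / x" "(x + y) / y = 1 + inverse (y / x)"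
      by (simp_all add: field_simps)
    then show ?thesis
      using False le val_ring_add[OF R val_ring_1[OF R]] val_ring_inverse[OF R, of "y / x"] by metis
  next
    case True
    have "ext_le G (val v w) (val v w)" for w
      using le[of w w] val_ring_1[OF R] by (cases "w = 0") (simp_all add: v_def)
    then show ?thesis using True by auto
  qed
  have "val v ` (- {0}) = Some ` carrier G"
    by (auto simp: v_def G_def image_image)
  moreover have "val v (x * y) = ext_mult G (val v x) (val v y)" for x y
    by (simp add: v_def mult_h)
  ultimately have "krull_valuation v"
    using oag add by (simp add: krull_valuation_def v_def)
  moreover have "valuation_ring v = R"
  proof -
    have "Some \<one>\<^bsub>G\<^esub> = val v 1" by (simp add: v_def one)
    then show ?thesis using le[of 1] by (auto simp: valuation_ring_def v_def)
  qed
  ultimately show thesis by (rule that)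
qed

text \<open>The inequality of the theorem is assumed for finest common coarsenings \<open>w\<close>,
  so one has to be exhibited together with an explicit description of its ring. The compositum is
  the smallest common overring, hence the finest coarsening.\<close>

lemma ex_finest_common_coarsening:
  fixes v1 v2 :: "('a::field, 'a set) valuation"
  assumes "krull_valuation v1" "krull_valuation v2"
  obtains w where "finest_common_coarsening w v1 v2"
    "valuation_ring w = ring_prod (valuation_ring v1) (valuation_ring v2)"
proof -
  have R: "val_ring (valuation_ring v1)" "val_ring (valuation_ring v2)"
    using assms by (simp_all add: krull.val_ring_R krull_def)
  obtain w :: "('a, 'a set) valuation" where w: "krull_valuation w"
    "valuation_ring w = ring_prod (valuation_ring v1) (valuation_ring v2)"
    using ex_valuation_of_val_ring[OF val_ring_ring_prod[OF R]] .
  have "finest_common_coarsening w v1 v2"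
    unfolding finest_common_coarsening_def coarsening_def w(2)
  proof (intro conjI allI impI w(1) ring_prod_upper[OF R])
    fix u :: "('a, 'a set) valuation"
    assume u: "krull_valuation u \<and> valuation_ring v1 \<subseteq> valuation_ring u \<and> valuation_ring v2 \<subseteq> valuation_ring u"
    then have "val_ring (valuation_ring u)" by (simp add: krull.val_ring_R krull_def)
    with u show "ring_prod (valuation_ring v1) (valuation_ring v2) \<subseteq> valuation_ring u"
      by (simp add: ring_prod_least)
  qed
  then show thesis using w(2) that by blast
qed

section \<open>Degrees of finite field extensions\<close>

context ring
begin

text \<open>The pairs \<open>(k, w)\<close> parametrise the line extension without repetition: if
  two pairs with \<open>k \<noteq> k'\<close> gave the same element, dividing by
  \<open>k \<ominus> k'\<close> would put \<open>u\<close> into \<open>E\<close>.\<close>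

lemma card_line_extension:
  assumes K: "subfield K R" and E: "subgroup E (add_monoid R)" "\<And>k w. k \<in> K \<Longrightarrow> w \<in> E \<Longrightarrow> k \<otimes> w \<in> E"
    and u: "u \<in> carrier R" "u \<notin> E"
  shows "card (line_extension K u E) = card K * card E"
proof -
  note Kc = subfieldE(3)[OF K]
  have Ec: "E \<subseteq> carrier R" using add.subgroupE(1)[OF E(1)] by simp
  have "inj_on (\<lambda>(k, w). k \<otimes> u \<oplus> w) (K \<times> E)"
  proof (rule inj_onI, clarify)
    fix k w k' w'
    assume *: "k \<in> K" "w \<in> E" "k' \<in> K" "w' \<in> E" "k \<otimes> u \<oplus> w = k' \<otimes> u \<oplus> w'"
    then have c: "k \<in> carrier R" "k' \<in> carrier R" "w \<in> carrier R" "w' \<in> carrier R" using Kc Ec by auto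
    have "(k \<ominus> k') \<otimes> u = (k \<otimes> u \<oplus> w) \<ominus> (k' \<otimes> u \<oplus> w')  \<oplus> (w' \<ominus> w)"
      using c u(1) by algebra
    also have "\<dots> = w' \<ominus> w" using c u(1) unfolding *(5) by algebra
    finally have eq: "(k \<ominus> k') \<otimes> u = w' \<ominus> w" .
    have wE: "w' \<ominus> w \<in> E"
      using *(2,4) add.subgroupE(3,4)[OF E(1)] by (simp add: a_minus_def)
    have "k = k'"
    proof (rule ccontr)
      assume "k \<noteq> k'"
      then have "k \<ominus> k' \<noteq> \<zero>" using c by simp
      moreover have "k \<ominus> k' \<in> K"
        using subringE(5,7)[OF subfieldE(1)[OF K]] * by (simp add: a_minus_def)
      ultimately have d: "k \<ominus> k' \<in> K - {\<zero>}" by simp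
      note i = subfield_m_inv[OF K d]
      have "u = inv (k \<ominus> k') \<otimes> ((k \<ominus> k') \<otimes> u)"
        using i Kc c u(1) by (subst m_assoc[symmetric]) auto
      also have "\<dots> \<in> E" unfolding eq using i wE E(2) by auto
      finally show False using u by simp
    qed
    moreover from this have "w = w'" using * c u(1) by simp
    ultimately show "k = k' \<and> w = w'" by simp
  qed
  moreover have "line_extension K u E = (\<lambda>(k, w). k \<otimes> u \<oplus> w) ` (K \<times> E)"
    by (auto simp: line_extension_mem_iff image_iff) blast
  ultimately show ?thesis by (simp add: card_image card_cartesian_product)
qed

lemma dimension_subspace:
  assumes K: "subfield K R" and "dimension n K E"
  shows "subgroup E (add_monoid R) \<and> (\<forall>k\<in>K. \<forall>w\<in>E. k \<otimes> w \<in> E)"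
  using assms(2,1)
proof (induction n K E rule: dimension.induct)
  case (zero_dim K)
  then have "K \<subseteq> carrier R" by (rule subfieldE(3))
  then show ?case by (auto intro!: add.subgroupI)
next
  case (Suc_dim u E n K)
  then have E: "subgroup E (add_monoid R)" "\<And>k w. k \<in> K \<Longrightarrow> w \<in> E \<Longrightarrow> k \<otimes> w \<in> E" by auto
  have "E \<subseteq> carrier R" using add.subgroupE(1)[OF E(1)] by simp
  then show ?case
    using line_extension_is_subgroup[OF Suc_dim.prems E(1) Suc_dim.hyps(1)]
      line_extension_smult_closed[OF Suc_dim.prems E(2) _ Suc_dim.hyps(1)] by blast
qed

lemma card_dimension:
  assumes K: "subfield K R" and "dimension n K E"
  shows "card E = card K ^ n"
  using assms(2,1)
proof (induction n K E rule: dimension.induct)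
  case (Suc_dim u E n K)
  then show ?case
    using card_line_extension[OF Suc_dim.prems] dimension_subspace[OF Suc_dim.prems Suc_dim.hyps(3)] by simp
qed simp

lemma dimension_dim_carrier:
  assumes K: "subfield K R" and fin: "finite (carrier R)"
  shows "dimension (dim K (carrier R)) K (carrier R)"
proof -
  obtain Us where Us: "set Us = carrier R" using finite_list[OF fin] by blast
  obtain Vs where Vs: "set Vs \<subseteq> carrier R" "independent K Vs" "Span K Vs = Span K Us"
    using filter_base[OF K, of Us] Us by auto
  have "Span K Us = carrier R"
    using Span_base_incl[OF K, of Us] Span_in_carrier[OF subfieldE(3)[OF K], of Us] Us by simp
  then have "dimension (length Vs) K (carrier R)"
    using dimension_independent[OF Vs(2)] Vs(3) by simp
  then show ?thesis using dimI[OF K] by (simp add: over_def)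
qed

end

text \<open>Euclid's algorithm on the exponents: \<open>q ^ f - 1\<close> is congruent to
  \<open>q ^ (f - d) - 1\<close> modulo \<open>q ^ d - 1\<close>, and once the exponent is below
  \<open>d\<close>, size forces it to be 0.\<close>

lemma power_minus_one_dvd_imp:
  fixes q :: nat
  assumes q: "q \<ge> 2" and d: "d > 0" and dvd: "q ^ d - 1 dvd q ^ f - 1"
  shows "d dvd f"
  using dvd
proof (induction f rule: less_induct)
  case (less f)
  show ?case
  proof (cases "f < d")
    case True
    have "f = 0"
    proof (rule ccontr)
      assume "f \<noteq> 0"
      then have "q ^ f - 1 > 0" using one_less_power[of q f] q by simp
      then have "q ^ d - 1 \<le> q ^ f - 1" using less.prems by (rule dvd_imp_le[rotated])
      moreover have "q ^ f < q ^ d" using True q by simp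
      ultimately show False using \<open>q ^ f - 1 > 0\<close> by linarith
    qed
    then show ?thesis by simp
  next
    case False
    then have "q ^ f - 1 = q ^ (f - d) * (q ^ d - 1) + (q ^ (f - d) - 1)"
      using q by (simp add: algebra_simps flip: power_add)
    then have "q ^ d - 1 dvd q ^ (f - d) - 1"
      using less.prems by (metis dvd_add_right_iff dvd_triv_right)
    then have "d dvd f - d" using less.IH[of "f - d"] d False by simp
    then show ?thesis using dvd_add[of d "f - d" d] False by simp
  qed
qed

context field
begin

lemma finite_field_pow_card:
  assumes "finite (carrier R)" "x \<in> carrier R"
  shows "x [^] card (carrier R) = x"
proof (cases "x = \<zero>")
  case True
  have "card (carrier R) > 0" using assms by (auto simp: card_gt_0_iff)
  then show ?thesis using True by (simp add: nat_pow_zero)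
next
  case False
  interpret M: group "Multiplicative_Group.mult_of R" by (rule field_mult_group)
  have "x [^]\<^bsub>Multiplicative_Group.mult_of R\<^esub> order (Multiplicative_Group.mult_of R) = \<one>\<^bsub>Multiplicative_Group.mult_of R\<^esub>"
    using assms False by (intro M.pow_order_eq_1) auto
  then have "x [^] (card (carrier R) - 1) = \<one>"
    using assms(1) by (simp add: Multiplicative_Group.nat_pow_mult_of order_mult_of) (simp add: order_def)
  moreover have "card (carrier R) = Suc (card (carrier R) - 1)"
    using assms card_gt_0_iff[of "carrier R"] by auto
  ultimately show ?thesis using assms(2) by (metis l_one nat_pow_Suc)
qed

text \<open>From left to right, iterate \<open>x [^] card (carrier R) = x\<close>. Conversely, a
  generator of the cyclic multiplicative group has order \<open>card K ^ d - 1\<close>, which must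
  divide \<open>card K ^ f - 1\<close>. Thus a condition on the residue degree can be tested element
  by element.\<close>

lemma finite_field_dim_dvd_iff:
  assumes fin: "finite (carrier R)" and K: "subfield K R" and f: "f > 0"
  shows "dim K (carrier R) dvd f \<longleftrightarrow> (\<forall>x\<in>carrier R. x [^] (card K ^ f) = x)"
proof
  define d where "d = dim K (carrier R)"
  have card: "card (carrier R) = card K ^ d"
    using card_dimension[OF K dimension_dim_carrier[OF K fin]] by (simp add: d_def)
  have Kfin: "finite K" using subfieldE(3)[OF K] fin finite_subset by blast
  have K01: "{\<zero>, \<one>} \<subseteq> K" using subringE(2,3)[OF subfieldE(1)[OF K]] by simp
  have q: "card K \<ge> 2" using card_mono[OF Kfin K01] by simp
  have "card (carrier R) \<ge> 2"
    using card_mono[OF fin subfieldE(3)[OF K]] q by linarith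
  then have d0: "d > 0" unfolding card by (cases d) auto
  {
    assume "d dvd f"
    then obtain m where m: "f = d * m" by auto
    have "x [^] (card K ^ (d * m)) = x" if "x \<in> carrier R" for x
    proof (induction m)
      case (Suc m)
      have "x [^] (card K ^ (d * Suc m)) = (x [^] (card K ^ (d * m))) [^] (card K ^ d)"
        using that by (simp add: nat_pow_pow power_add mult.commute)
      then show ?case using Suc finite_field_pow_card[OF fin that] card by simp
    qed (use that in simp)
    then show "\<forall>x\<in>carrier R. x [^] (card K ^ f) = x" unfolding m by blast
  }
  {
    assume *: "\<forall>x\<in>carrier R. x [^] (card K ^ f) = x"
    interpret M: group "Multiplicative_Group.mult_of R" by (rule field_mult_group)
    obtain a where a: "a \<in> carrier (Multiplicative_Group.mult_of R)" "carrier (Multiplicative_Group.mult_of R) = {a [^] i |i::nat. i \<in> UNIV}"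
      using finite_field_mult_group_has_gen[OF fin] by blast
    have finM: "finite (carrier (Multiplicative_Group.mult_of R))" using fin by simp
    have "carrier (Multiplicative_Group.mult_of R) = generate (Multiplicative_Group.mult_of R) {a}"
      using a(2) M.generate_pow_nat[OF a(1)] M.ord_ge_1[OF finM a(1)] by (simp add: Multiplicative_Group.nat_pow_mult_of)
    then have ord: "M.ord a = card K ^ d - 1"
      using M.generate_pow_card[OF a(1)] order_mult_of[OF fin] card by (simp add: order_def)
    have ac: "a \<in> carrier R" "a \<noteq> \<zero>" using a by auto
    have "card K ^ f > 0" using q by simp
    then have Suc: "card K ^ f = Suc (card K ^ f - 1)" by simp
    have "a [^] (card K ^ f - 1) \<otimes> a = \<one> \<otimes> a"
      using *[rule_format, OF ac(1)] Suc ac by (metis l_one nat_pow_Suc)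
    then have "a [^] (card K ^ f - 1) = \<one>"
      using ac m_rcancel[of a "a [^] (card K ^ f - 1)" \<one>] by simp
    then have "a [^]\<^bsub>Multiplicative_Group.mult_of R\<^esub> (card K ^ f - 1) = \<one>\<^bsub>Multiplicative_Group.mult_of R\<^esub>" by (simp add: Multiplicative_Group.nat_pow_mult_of)
    then have "card K ^ d - 1 dvd card K ^ f - 1"
      using M.pow_eq_id[OF a(1)] ord by simp
    then show "d dvd f" using power_minus_one_dvd_imp[OF q d0] by blast
  }
qed

text \<open>All elements are roots of one nonzero polynomial. This recovers the finiteness of a
  residue field from \<open>residues_fixed\<close>.\<close>

lemma finite_carrier_if_pow_eq:
  assumes N: "N \<ge> 2" and eq: "\<And>x. x \<in> carrier R \<Longrightarrow> x [^] (N::nat) = x"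
  shows "finite (carrier R)"
proof -
  \<comment> \<open>The coefficients of \<open>X^N - X\<close>, leading one first. The last two
    entries belong to \<open>X\<close> and 1, which leaves \<open>N - 2\<close> zeros.\<close>
  define p where "p = \<one> # replicate (N - 2) \<zero> @ [\<ominus> \<one>, \<zero>]"
  have "p \<in> carrier (poly_ring R)"
    unfolding p_def univ_poly_carrier[symmetric] polynomial_def by auto
  moreover have "is_root p x" if x: "x \<in> carrier R" for x
  proof -
    have "eval p x = x [^] N \<oplus> eval (replicate (N - 2) \<zero> @ [\<ominus> \<one>, \<zero>]) x"
      using x N by (simp add: p_def Suc_diff_Suc numeral_2_eq_2)
    also have "\<dots> = x [^] N \<oplus> eval [\<ominus> \<one>, \<zero>] x"
      using x by (subst eval_replicate) auto
    also have "\<dots> = \<zero>" using x eq[OF x] by (simp add: l_minus r_neg)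
    finally show ?thesis using x by (simp add: is_root_def p_def)
  qed
  ultimately show ?thesis using finite_number_of_roots[of p] by (auto elim: finite_subset[rotated])
qed

end

section \<open>Uniformizing elements\<close>

text \<open>An element of least positive value, expressed by the ring. The rank may exceed one, so
  there may be nonzero elements divisible by all powers of \<open>\<pi>\<close>.\<close>

definition uniformizing :: "'a::field set \<Rightarrow> 'a \<Rightarrow> bool" where
  "uniformizing R \<pi> \<longleftrightarrow> \<pi> \<noteq> 0 \<and> \<pi> \<in> nonunits R \<and> (\<forall>a\<in>nonunits R. a / \<pi> \<in> R)"

text \<open>Divide by \<open>\<pi>\<close> as long as the quotient is a nonunit; the bound by
  \<open>\<pi> ^ n\<close> ends this after at most \<open>n\<close> divisions. That both quotients
  lie in \<open>R\<close> means that \<open>x\<close> and \<open>\<pi> ^ m\<close> have the same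
  value.\<close>

lemma uniformizing_below_power:
  assumes R: "val_ring R" and \<pi>: "uniformizing R \<pi>"
    and "x \<noteq> 0" "x \<in> R" "\<pi> ^ n / x \<in> R"
  shows "\<exists>m\<le>n. x / \<pi> ^ m \<in> R \<and> \<pi> ^ m / x \<in> R"
  using assms(3-)
proof (induction n arbitrary: x)
  case (Suc n)
  show ?case
  proof (cases "x \<in> nonunits R")
    case True
    have \<pi>0: "\<pi> \<noteq> 0" using \<pi> by (simp add: uniformizing_def)
    then have "\<exists>m\<le>n. (x / \<pi>) / \<pi> ^ m \<in> R \<and> \<pi> ^ m / (x / \<pi>) \<in> R"
      using Suc.prems True \<pi> by (intro Suc.IH) (simp_all add: uniformizing_def mult.commute)
    then obtain m where m: "m \<le> n" "(x / \<pi>) / \<pi> ^ m \<in> R" "\<pi> ^ m / (x / \<pi>) \<in> R" by blast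
    then have "x / \<pi> ^ Suc m \<in> R" "\<pi> ^ Suc m / x \<in> R" by (simp_all add: mult.commute)
    then show ?thesis using m(1) by blast
  next
    case False
    then have "inverse x \<in> R" using Suc.prems by (simp add: nonunits_def)
    then show ?thesis using Suc.prems by (intro exI[of _ 0]) (simp add: divide_inverse)
  qed
qed auto

lemma uniformizing_power_unit:
  assumes "val_ring R" "uniformizing R \<pi>" "inverse (\<pi> ^ n) \<in> R"
  shows "n = 0"
  using assms nonunits_power[of R \<pi> n] by (auto simp: uniformizing_def nonunits_def)

lemma uniformizing_unique:
  assumes "uniformizing R \<pi>" "uniformizing R \<pi>'"
  shows "\<pi> / \<pi>' \<in> R" "\<pi>' / \<pi> \<in> R"
  using assms by (auto simp: uniformizing_def)

context krull
begin

lemma gle_one_iff: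
  assumes "val v a = Some \<alpha>" "a \<noteq> 0"
  shows "gle G \<one> \<alpha> \<longleftrightarrow> a \<in> R"
  using assms by (simp add: in_R)

text \<open>Convexity holds because an element of \<open>R\<close> that divides a power of
  \<open>\<pi>\<close> has the value of such a power. Minimality holds because a nontrivial convex
  subgroup contains a positive element, and this is at least \<open>\<alpha>\<close>.\<close>

lemma is_int_embedding_pow:
  assumes \<pi>: "uniformizing R \<pi>" and \<alpha>: "val v \<pi> = Some \<alpha>" "\<alpha> \<in> carrier G"
  shows "is_int_embedding G (\<lambda>n. \<alpha> [^] (n::int))"
proof -
  have \<pi>0: "\<pi> \<noteq> 0" "\<pi> \<in> R" using \<pi> by (auto simp: uniformizing_def nonunits_subset)
  have vp: "val v (\<pi> ^ k) = Some (\<alpha> [^] k)" for k :: nat using val_power[OF \<alpha>] .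
  have nat_le: "gle G \<one> (\<alpha> [^] k)" for k :: nat
    using gle_one_iff[OF vp[of k]] \<pi>0 val_ring_power[OF val_ring_R] by simp
  have le: "gle G (\<alpha> [^] m) (\<alpha> [^] n)" if "m \<le> n" for m n :: int
  proof -
    have "\<alpha> [^] n = \<alpha> [^] nat (n - m) \<otimes> \<alpha> [^] m"
      using that \<alpha>(2) int_pow_mult[of \<alpha> "n - m" m] by (simp add: int_pow_int[symmetric])
    then show ?thesis using gle_mult[OF _ _ _ nat_le[of "nat (n - m)"], of "\<alpha> [^] m"] \<alpha>(2) by simp
  qed
  have inj: "m = n" if mn: "m \<le> n" and eq: "\<alpha> [^] m = \<alpha> [^] n" for m n :: int
  proof -
    have "\<alpha> [^] n = \<alpha> [^] nat (n - m) \<otimes> \<alpha> [^] m"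
      using mn \<alpha>(2) int_pow_mult[of \<alpha> "n - m" m] by (simp add: int_pow_int[symmetric])
    then have "\<one> \<otimes> \<alpha> [^] m = \<alpha> [^] nat (n - m) \<otimes> \<alpha> [^] m" using eq \<alpha>(2) by simp
    then have "\<alpha> [^] nat (n - m) = \<one>" using \<alpha>(2) right_cancel by (metis int_pow_closed nat_pow_closed one_closed)
    then have "val v (\<pi> ^ nat (n - m)) = val v 1" using vp val_1 by simp
    then have "inverse (\<pi> ^ nat (n - m)) \<in> R"
      using val_eq_iff[of "\<pi> ^ nat (n - m)" 1] \<pi>0 by (simp add: divide_inverse)
    then show ?thesis using uniformizing_power_unit[OF val_ring_R \<pi>] mn by fastforce
  qed
  have le_iff: "gle G (\<alpha> [^] m) (\<alpha> [^] n) \<longleftrightarrow> m \<le> n" for m n :: int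
    using le[of m n] le[of n m] inj[of n m] gle_antisym[of "\<alpha> [^] m" "\<alpha> [^] n"] \<alpha>(2)
    by (metis int_pow_closed linorder_le_cases)
  have hom: "(\<lambda>n. \<alpha> [^] (n::int)) \<in> hom integer_group G" using hom_integer_group_pow[OF \<alpha>(2)] .
  interpret h: group_hom integer_group G "\<lambda>n. \<alpha> [^] (n::int)"
    using hom by (simp add: group_hom_def group_hom_axioms_def is_group)
  have "subgroup (range (\<lambda>n. \<alpha> [^] (n::int))) G" using h.img_is_subgroup by simp
  moreover have "b \<in> range (\<lambda>n. \<alpha> [^] (n::int))"
    if a: "a \<in> range (\<lambda>n. \<alpha> [^] (n::int))" and b: "b \<in> carrier G" "gle G \<one> b" "gle G b a" for a b
  proof -
    obtain n where n: "a = \<alpha> [^] (n::int)" using a by auto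
    have "gle G (\<alpha> [^] (0::int)) (\<alpha> [^] n)" using gle_trans[OF _ b(1) _ b(2,3)] n \<alpha>(2) by simp
    then have "n \<ge> 0" unfolding le_iff .
    then obtain k where k: "n = int k" using nonneg_int_cases by blast
    obtain x where x: "x \<noteq> 0" "val v x = Some b" using val_surj[OF b(1)] .
    have "x \<in> R" using gle_one_iff[OF x(2,1)] b by simp
    moreover have "\<pi> ^ k / x \<in> R" using ext_le_val[OF x(1), of "\<pi> ^ k"] x vp b n k by (simp add: int_pow_int)
    ultimately obtain m where "x / \<pi> ^ m \<in> R" "\<pi> ^ m / x \<in> R"
      using uniformizing_below_power[OF val_ring_R \<pi> x(1)] by blast
    then have "val v x = val v (\<pi> ^ m)" using val_eq_iff[OF x(1), of "\<pi> ^ m"] \<pi>0 by simp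
    then have "b = \<alpha> [^] int m" using x vp by (simp add: int_pow_int)
    then show ?thesis by blast
  qed
  ultimately have "convex_subgroup (range (\<lambda>n. \<alpha> [^] (n::int))) G" by (simp add: convex_subgroup_def)
  moreover have "range (\<lambda>n. \<alpha> [^] (n::int)) \<subseteq> H" if H: "convex_subgroup H G" "H \<noteq> {\<one>}" for H
  proof -
    interpret H: subgroup H G using H(1) by (simp add: convex_subgroup_def)
    obtain g where g: "g \<in> H" "g \<noteq> \<one>" using H(2) H.one_closed by blast
    have "\<exists>g\<in>H. g \<noteq> \<one> \<and> gle G \<one> g"
    proof (cases "gle G \<one> g")
      case False
      then have "gle G g \<one>" using gle_total[of \<one> g] g by auto
      then have "gle G (g \<otimes> inv g) (\<one> \<otimes> inv g)" using g by (intro gle_mult) auto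
      then have "gle G \<one> (inv g)" using g by simp
      moreover have "inv g \<noteq> \<one>" using g by (metis H.mem_carrier inv_inv inv_one)
      ultimately show ?thesis using g by blast
    qed (use g in blast)
    then obtain g where g: "g \<in> H" "g \<noteq> \<one>" "gle G \<one> g" by blast
    obtain x where x: "x \<noteq> 0" "val v x = Some g" using val_surj[of g] g by auto
    have "ext_less G (val v 1) (val v x)" using g x by (simp add: val_1 ext_less_def)
    then have "x \<in> nonunits R" using ext_less_val[of 1 x] by simp
    then have "x / \<pi> \<in> R" using \<pi> by (simp add: uniformizing_def)
    then have "gle G \<alpha> g" using ext_le_val[OF \<pi>0(1), of x] x \<alpha> by simp
    moreover have "gle G \<one> \<alpha>" using nat_le[of 1] \<alpha> by simp
    ultimately have "\<alpha> \<in> H" using H(1) g \<alpha> unfolding convex_subgroup_def by blast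
    then show ?thesis using H.subgroup_axioms subgroup_int_pow_closed by blast
  qed
  ultimately show ?thesis
    unfolding is_int_embedding_def using hom le_iff by blast
qed

text \<open>A value strictly between \<open>\<one>\<close> and \<open>j 1\<close> would lie in the
  convex \<open>range j\<close>, hence be \<open>j m\<close> with \<open>0 < m < 1\<close>.\<close>

lemma uniformizing_if_int_embedding:
  assumes j: "is_int_embedding G j" and t: "val v t = Some (j 1)"
  shows "uniformizing R t"
proof -
  have hom: "j \<in> hom integer_group G" and le: "\<And>m n. gle G (j m) (j n) \<longleftrightarrow> m \<le> n"
    and conv: "convex_subgroup (range j) G"
    using j by (auto simp: is_int_embedding_def)
  have jc: "j n \<in> carrier G" for n using hom by (auto simp: hom_def)
  have j0: "j 0 = \<one>" using hom_one[OF hom group_integer_group is_group] by simp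
  have t0: "t \<noteq> 0" using t val_0 by auto
  have "gle G \<one> (j 1)" "\<not> gle G (j 1) \<one>" using le[of 0 1] le[of 1 0] j0 by simp_all
  then have "ext_less G (val v 1) (val v t)" using t val_1 jc[of 1] gle_refl by (auto simp: ext_less_def)
  then have tM: "t \<in> nonunits R" using ext_less_val[of 1 t] by simp
  have "a / t \<in> R" if a: "a \<in> nonunits R" for a
  proof (cases "a = 0")
    case False
    obtain \<alpha> where \<alpha>: "\<alpha> \<in> carrier G" "val v a = Some \<alpha>" using val_nonzero[OF False] .
    have less: "gle G \<one> \<alpha>" "\<alpha> \<noteq> \<one>"
      using ext_less_val[of 1 a] a \<alpha> val_1 by (auto simp: ext_less_def)
    have "gle G (j 1) \<alpha>"
    proof (rule ccontr)
      assume n: "\<not> gle G (j 1) \<alpha>"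
      then have "gle G \<alpha> (j 1)" using gle_total jc \<alpha> by blast
      then have "\<alpha> \<in> range j" using conv less \<alpha> unfolding convex_subgroup_def by blast
      then obtain m where m: "\<alpha> = j m" by auto
      then show False using n less le[of 0 m] le[of 1 m] j0 by (cases "m = 0") auto
    qed
    then show ?thesis using ext_le_val[OF t0, of a] t \<alpha> by simp
  qed (simp add: val_ring_0[OF val_ring_R])
  then show ?thesis using t0 tM by (simp add: uniformizing_def)
qed

text \<open>\<open>int_embedding\<close> is a definite description, so uniqueness is needed. For any
  embedding \<open>j\<close>, the element \<open>j 1\<close> is the value of a uniformizing element,
  hence equals \<open>\<alpha>\<close>, and a homomorphism on the integers is determined at
  1.\<close>

lemma int_embedding_eq:
  assumes \<pi>: "uniformizing R \<pi>"
  shows "is_int_embedding G (int_embedding G)"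
    and "val v (\<pi> ^ n) = Some (int_embedding G (int n))"
proof -
  have \<pi>0: "\<pi> \<noteq> 0" using \<pi> by (simp add: uniformizing_def)
  obtain \<alpha> where \<alpha>: "\<alpha> \<in> carrier G" "val v \<pi> = Some \<alpha>" using val_nonzero[OF \<pi>0] .
  note emb = is_int_embedding_pow[OF \<pi> \<alpha>(2,1)]
  have uniq: "j = (\<lambda>n. \<alpha> [^] (n::int))" if j: "is_int_embedding G j" for j
  proof
    fix n :: int
    have hom: "j \<in> hom integer_group G" using j by (simp add: is_int_embedding_def)
    then have "j 1 \<in> carrier G" by (auto simp: hom_def)
    then obtain t where t: "t \<noteq> 0" "val v t = Some (j 1)" using val_surj by blast
    have "val v \<pi> = val v t"
      using val_eq_iff[OF \<pi>0 t(1)] uniformizing_unique[OF \<pi> uniformizing_if_int_embedding[OF j t(2)]] by simp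
    then have "j 1 = \<alpha>" using t \<alpha> by simp
    then show "j n = \<alpha> [^] n"
      using hom_int_pow[OF hom, of 1 n] is_group by simp
  qed
  have eq: "int_embedding G = (\<lambda>n. \<alpha> [^] (n::int))"
    unfolding int_embedding_def by (intro the_equality emb uniq)
  show "is_int_embedding G (int_embedding G)" using emb eq by simp
  show "val v (\<pi> ^ n) = Some (int_embedding G (int n))"
    using val_power[OF \<alpha>(2,1)] eq by (simp add: int_pow_int)
qed

end

section \<open>Residue fields\<close>

text \<open>The residue field is built from the ring alone, since admissible rings arise as mere
  sets without a valuation. \<open>residue_field_eq\<close> identifies it with the residue field of
  a valuation.\<close>

locale val_ring_locale =
  fixes R :: "'a::field set"
  assumes val_ring: "val_ring R"
begin

definition alg :: "'a ring" where
  "alg = ring_of_type_algebra\<lparr>carrier := R\<rparr>"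

lemma alg_simps [simp]:
  "carrier alg = R" "x \<otimes>\<^bsub>alg\<^esub> y = x * y" "x \<oplus>\<^bsub>alg\<^esub> y = x + y" "\<one>\<^bsub>alg\<^esub> = 1" "\<zero>\<^bsub>alg\<^esub> = 0"
  by (simp_all add: alg_def ring_of_type_algebra_def)

lemma cring_alg: "cring alg"
proof (rule cringI)
  show "abelian_group alg"
  proof (rule abelian_groupI)
    fix x assume "x \<in> carrier alg"
    then show "\<exists>y\<in>carrier alg. y \<oplus>\<^bsub>alg\<^esub> x = \<zero>\<^bsub>alg\<^esub>"
      using val_ring_uminus[OF val_ring] by (intro bexI[of _ "- x"]) auto
  qed (auto simp: val_ring_0[OF val_ring] val_ring_add[OF val_ring] add_ac)
  show "comm_monoid alg"
    by (rule comm_monoidI) (auto simp: val_ring_1[OF val_ring] val_ring_mult[OF val_ring] mult_ac)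
qed (simp add: distrib_right)

sublocale alg: cring alg by (rule cring_alg)

lemma alg_uminus: "x \<in> R \<Longrightarrow> \<ominus>\<^bsub>alg\<^esub> x = - x"
  using alg.minus_equality[of "- x" x] val_ring_uminus[OF val_ring] by simp

lemma alg_minus: "x \<in> R \<Longrightarrow> y \<in> R \<Longrightarrow> x \<ominus>\<^bsub>alg\<^esub> y = x - y"
  by (simp add: a_minus_def alg_uminus)

lemma alg_pow: "x [^]\<^bsub>alg\<^esub> (n::nat) = x ^ n"
  by (induction n) (simp_all add: mult.commute)

lemma maximalideal_nonunits: "maximalideal (nonunits R) alg"
proof (rule maximalidealI)
  show "ideal (nonunits R) alg"
  proof (rule idealI)
    show "subgroup (nonunits R) (add_monoid alg)"
    proof (rule alg.add.subgroupI)
      show "nonunits R \<noteq> {}" using nonunits_0[OF val_ring] by auto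
    qed (auto simp: nonunits_subset alg_uminus nonunits_uminus[OF val_ring] nonunits_add[OF val_ring]
        simp flip: a_inv_def)
  qed (auto simp: alg.ring_axioms nonunits_mult[OF val_ring])
  show "carrier alg \<noteq> nonunits R"
    using val_ring_1[OF val_ring] one_notin_nonunits[OF val_ring] by auto
  fix J assume J: "ideal J alg" "nonunits R \<subseteq> J" "J \<subseteq> carrier alg"
  show "J = nonunits R \<or> J = carrier alg"
  proof (rule disjCI)
    interpret J: ideal J alg by (rule J(1))
    assume "J \<noteq> carrier alg"
    have "x \<in> nonunits R" if "x \<in> J" for x
    proof (rule ccontr)
      assume "x \<notin> nonunits R"
      moreover have "x \<in> R" using that J(3) by auto
      ultimately have "inverse x \<in> R" "x \<noteq> 0" using nonunits_0[OF val_ring] by (auto simp: unit_inverse)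
      then have "1 \<in> J" using J.I_l_closed[OF that, of "inverse x"] by simp
      then show False using J.one_imp_carrier \<open>J \<noteq> carrier alg\<close> by simp
    qed
    then show "J = nonunits R" using J(2) by blast
  qed
qed

sublocale max: maximalideal "nonunits R" alg by (rule maximalideal_nonunits)

definition res :: "'a set ring" where "res = alg Quot nonunits R"

definition rc :: "'a \<Rightarrow> 'a set" where "rc a = nonunits R +>\<^bsub>alg\<^esub> a"

lemma field_res: "field res"
  unfolding res_def by (rule max.quotient_is_field[OF cring_alg])

sublocale res: field res by (rule field_res)

lemma rc_hom: "ring_hom_ring alg res rc"
  using max.rcos_ring_hom_ring unfolding res_def rc_def[abs_def] .

sublocale rc: ring_hom_ring alg res rc by (rule rc_hom)

lemma rc_eq_iff: "a \<in> R \<Longrightarrow> b \<in> R \<Longrightarrow> rc a = rc b \<longleftrightarrow> a - b \<in> nonunits R"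
  using alg.quotient_eq_iff_same_a_r_cos[OF max.ideal_axioms, of a b]
  by (simp add: rc_def alg_minus)

lemma carrier_res: "carrier res = rc ` R"
  by (auto simp: res_def rc_def FactRing_def A_RCOSETS_def')

lemma rc_pow: "a \<in> R \<Longrightarrow> rc a [^]\<^bsub>res\<^esub> (n::nat) = rc (a ^ n)"
  using rc.hom_nat_pow[of a n] by (simp add: alg_pow)

lemma residues_fixed_iff:
  "residues_fixed N R \<longleftrightarrow> (\<forall>x\<in>carrier res. x [^]\<^bsub>res\<^esub> N = x)"
  by (simp add: residues_fixed_def carrier_res rc_pow rc_eq_iff val_ring_power[OF val_ring])

lemma of_nat_in: "of_nat m \<in> R"
  by (induction m) (simp_all add: val_ring_0[OF val_ring] val_ring_1[OF val_ring] val_ring_add[OF val_ring])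

lemma res_add_pow_one: "[m] \<cdot>\<^bsub>res\<^esub> \<one>\<^bsub>res\<^esub> = rc (of_nat m)" for m :: nat
proof (induction m)
  case (Suc m)
  then show ?case
    using rc.hom_add[of "of_nat m" 1] rc.hom_one by (simp add: of_nat_in val_ring_1[OF val_ring] add.commute)
qed (use rc.hom_zero in simp)

lemma has_characteristic_iff:
  "has_characteristic res p \<longleftrightarrow> (\<forall>m. of_nat m \<in> nonunits R \<longleftrightarrow> p dvd m)"
proof -
  have "rc (of_nat m) = \<zero>\<^bsub>res\<^esub> \<longleftrightarrow> of_nat m \<in> nonunits R" for m
    using rc_eq_iff[OF of_nat_in[of m] val_ring_0[OF val_ring]] rc.hom_zero by simp
  then show ?thesis by (simp add: has_characteristic_def res_add_pow_one)
qed

end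

lemma (in krull) residue_field_eq:
  "residue_field v = val_ring_locale.res R" "residue_class v = val_ring_locale.rc R"
proof -
  interpret V: val_ring_locale R by standard (rule val_ring_R)
  show "residue_field v = V.res" "residue_class v = V.rc"
    by (auto simp: residue_field_def V.res_def valuation_ring_alg_def V.alg_def maximal_ideal_of_eq
        residue_class_def V.rc_def fun_eq_iff)
qed

text \<open>Serves to show that the image of the base ring in the larger residue field has as many
  elements as the base residue field, without constructing an isomorphism.\<close>

lemma card_image_eq_if_same_kernel:
  assumes "\<And>a b. a \<in> A \<Longrightarrow> b \<in> A \<Longrightarrow> f a = f b \<longleftrightarrow> g a = g b"
  shows "card (f ` A) = card (g ` A)"
proof (rule bij_betw_same_card)
  have sel: "inv_into A f (f a) \<in> A" "f (inv_into A f (f a)) = f a" if "a \<in> A" for a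
    using that by (auto simp: inv_into_into f_inv_into_f)
  have eq: "g (inv_into A f (f a)) = g a" if "a \<in> A" for a
    using assms[OF sel(1)[OF that] that] sel(2)[OF that] by simp
  show "bij_betw (\<lambda>y. g (inv_into A f y)) (f ` A) (g ` A)"
    unfolding bij_betw_def inj_on_def using eq assms by (force simp: image_image)
qed

section \<open>Residue fields under an extension of valuation rings\<close>

locale val_ring_extension =
  B: val_ring_locale B + V: val_ring_locale R
  for B :: "'k::field set" and R :: "'f::field set" +
  fixes \<phi> :: "'k \<Rightarrow> 'f"
  assumes hom: "field_embedding \<phi>" and above: "\<And>a. \<phi> a \<in> R \<longleftrightarrow> a \<in> B"
begin

lemma \<phi>_add: "\<phi> (a + b) = \<phi> a + \<phi> b" and \<phi>_mult: "\<phi> (a * b) = \<phi> a * \<phi> b" and \<phi>_1: "\<phi> 1 = 1"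
  using hom by (auto simp: ring_hom_def ring_of_type_algebra_def)

lemma \<phi>_0: "\<phi> 0 = 0"
  using \<phi>_add[of 0 0] by (metis add_0 add_right_cancel)

lemma \<phi>_diff: "\<phi> (a - b) = \<phi> a - \<phi> b"
  using \<phi>_add[of "a - b" b] by simp

lemma \<phi>_inverse: "\<phi> (inverse a) = inverse (\<phi> a)"
proof (cases "a = 0")
  case False
  then have "\<phi> a * \<phi> (inverse a) = 1" using \<phi>_mult[of a "inverse a"] \<phi>_1 by simp
  then show ?thesis by (metis inverse_unique)
qed (simp add: \<phi>_0)

lemma \<phi>_eq_0_iff: "\<phi> a = 0 \<longleftrightarrow> a = 0"
  using \<phi>_mult[of a "inverse a"] \<phi>_0 \<phi>_1 by (cases "a = 0") auto

lemma \<phi>_of_nat: "\<phi> (of_nat n) = of_nat n"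
  by (induction n) (simp_all add: \<phi>_0 \<phi>_1 \<phi>_add)

lemma \<phi>_power: "\<phi> (a ^ n) = \<phi> a ^ n"
  by (induction n) (simp_all add: \<phi>_1 \<phi>_mult)

lemma \<phi>_divide: "\<phi> (a / b) = \<phi> a / \<phi> b"
  by (simp add: divide_inverse \<phi>_mult \<phi>_inverse)

lemma \<phi>_nonunits: "\<phi> a \<in> nonunits R \<longleftrightarrow> a \<in> nonunits B"
  using above[of "inverse a"] above[of a] by (simp add: nonunits_def \<phi>_inverse \<phi>_eq_0_iff)

lemma card_residue_image: "card ((\<lambda>a. V.rc (\<phi> a)) ` B) = card (carrier B.res)"
  unfolding B.carrier_res
  by (rule card_image_eq_if_same_kernel)
     (simp add: V.rc_eq_iff B.rc_eq_iff above \<phi>_nonunits flip: \<phi>_diff)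

lemma subfield_residue_image: "subfield ((\<lambda>a. V.rc (\<phi> a)) ` B) V.res"
proof (rule V.res.subfieldI')
  let ?K = "(\<lambda>a. V.rc (\<phi> a)) ` B"
  note Bring = B.val_ring
  have m: "\<ominus>\<^bsub>V.res\<^esub> V.rc (\<phi> a) = V.rc (\<phi> (- a))" if "a \<in> B" for a
    using V.rc.hom_a_inv[of "\<phi> a"] that \<phi>_diff[of 0 a] by (simp add: above V.alg_uminus \<phi>_0)
  show "subring ?K V.res"
  proof (rule V.res.subringI)
    show "?K \<subseteq> carrier V.res" by (auto simp: V.carrier_res above)
    show "\<one>\<^bsub>V.res\<^esub> \<in> ?K"
      using V.rc.hom_one val_ring_1[OF Bring] by (intro image_eqI[of _ _ 1]) (simp_all add: \<phi>_1)
  next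
    fix h assume "h \<in> ?K"
    then show "\<ominus>\<^bsub>V.res\<^esub> h \<in> ?K" using m val_ring_uminus[OF Bring] by auto
  next
    fix h1 h2 assume "h1 \<in> ?K" "h2 \<in> ?K"
    then obtain a b where ab: "a \<in> B" "h1 = V.rc (\<phi> a)" "b \<in> B" "h2 = V.rc (\<phi> b)" by auto
    then have "h1 \<otimes>\<^bsub>V.res\<^esub> h2 = V.rc (\<phi> (a * b))" "h1 \<oplus>\<^bsub>V.res\<^esub> h2 = V.rc (\<phi> (a + b))"
      using V.rc.hom_mult[of "\<phi> a" "\<phi> b"] V.rc.hom_add[of "\<phi> a" "\<phi> b"] by (simp_all add: above \<phi>_mult \<phi>_add)
    then show "h1 \<otimes>\<^bsub>V.res\<^esub> h2 \<in> ?K" "h1 \<oplus>\<^bsub>V.res\<^esub> h2 \<in> ?K"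
      using ab val_ring_mult[OF Bring] val_ring_add[OF Bring] by auto
  qed
  fix k assume "k \<in> ?K - {\<zero>\<^bsub>V.res\<^esub>}"
  then obtain a where a: "a \<in> B" "k = V.rc (\<phi> a)" "V.rc (\<phi> a) \<noteq> V.rc 0"
    using V.rc.hom_zero by auto
  then have an: "a \<notin> nonunits B"
    using V.rc_eq_iff[of "\<phi> a" 0] val_ring_0[OF V.val_ring] by (auto simp: above \<phi>_nonunits)
  then have a0: "a \<noteq> 0" and ai: "inverse a \<in> B"
    using a nonunits_0[OF Bring] by (auto simp: unit_inverse)
  have "V.rc (\<phi> (inverse a)) \<otimes>\<^bsub>V.res\<^esub> k = \<one>\<^bsub>V.res\<^esub>"
    using V.rc.hom_mult[of "\<phi> (inverse a)" "\<phi> a"] V.rc.hom_one a ai a0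
    by (simp add: above \<phi>_1 flip: \<phi>_mult)
  then have "inv\<^bsub>V.res\<^esub> k = V.rc (\<phi> (inverse a))"
    using a ai by (intro V.res.comm_inv_char) (auto simp: V.carrier_res above V.res.m_comm)
  then show "inv\<^bsub>V.res\<^esub> k \<in> ?K" using ai by auto
qed

lemma residue_dim_dvd_iff:
  assumes "finite (carrier V.res)" "f > 0"
  shows "ring.dim V.res ((\<lambda>a. V.rc (\<phi> a)) ` B) (carrier V.res) dvd f \<longleftrightarrow>
    residues_fixed (card (carrier B.res) ^ f) R"
  using V.res.finite_field_dim_dvd_iff[OF assms(1) subfield_residue_image assms(2)]
  by (simp add: card_residue_image V.residues_fixed_iff)

end

section \<open>Primes of bounded type\<close>

text \<open>A finite interval has a least element \<open>l\<close>, the value of a uniformizing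
  \<open>\<pi>\<close>. If \<open>c\<close> were divisible by all powers of \<open>\<pi>\<close>,
  these would have infinitely many values in the interval; so some power is divisible by
  \<open>c\<close>, and \<open>c\<close> has the value of a power. Conversely, the values in the
  interval are among those of \<open>\<pi> ^ i\<close> with \<open>i \<le> m\<close>.\<close>

lemma (in krull) finite_below_iff:
  assumes c: "c \<in> nonunits R" "c \<noteq> 0"
  shows "finite {\<gamma> \<in> carrier G. ext_less G (Some \<one>) (Some \<gamma>) \<and> ext_le G (Some \<gamma>) (val v c)} \<longleftrightarrow>
    (\<exists>\<pi> m. uniformizing R \<pi> \<and> c / \<pi> ^ m \<in> R \<and> \<pi> ^ m / c \<in> R)"
    (is "finite ?S \<longleftrightarrow> ?rhs")
proof -
  have S_iff: "\<gamma> \<in> ?S \<longleftrightarrow> x \<in> nonunits R \<and> c / x \<in> R" if "x \<noteq> 0" "val v x = Some \<gamma>" "\<gamma> \<in> carrier G" for x \<gamma>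
    using that ext_less_val[of 1 x] ext_le_val[of x c] by (simp add: val_1)
  have S_ex: "\<exists>x. x \<noteq> 0 \<and> val v x = Some \<gamma> \<and> x \<in> nonunits R \<and> c / x \<in> R" if "\<gamma> \<in> ?S" for \<gamma>
  proof -
    from that have "\<gamma> \<in> carrier G" by simp
    then obtain x where "x \<noteq> 0" "val v x = Some \<gamma>" using val_surj by blast
    with that show ?thesis using S_iff[of x \<gamma>] by blast
  qed
  show ?thesis
  proof
    assume ?rhs
    then obtain \<pi> m where \<pi>: "uniformizing R \<pi>" "\<pi> ^ m / c \<in> R" by blast
    have \<pi>0: "\<pi> \<noteq> 0" using \<pi> by (simp add: uniformizing_def)
    have "?S \<subseteq> (\<lambda>i. the (val v (\<pi> ^ i))) ` {..m}"
    proof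
      fix \<gamma> assume "\<gamma> \<in> ?S"
      then obtain x where x: "x \<noteq> 0" "val v x = Some \<gamma>" "x \<in> nonunits R" "c / x \<in> R" using S_ex by blast
      have "\<pi> ^ m / x \<in> R" using val_ring_mult[OF val_ring_R \<pi>(2) x(4)] c by simp
      then obtain i where i: "i \<le> m" "x / \<pi> ^ i \<in> R" "\<pi> ^ i / x \<in> R"
        using uniformizing_below_power[OF val_ring_R \<pi>(1) x(1) nonunits_subset[OF x(3)]] by blast
      then have "val v (\<pi> ^ i) = Some \<gamma>" using val_eq_iff[of x "\<pi> ^ i"] x \<pi>0 by simp
      then show "\<gamma> \<in> (\<lambda>i. the (val v (\<pi> ^ i))) ` {..m}" using i(1) by (intro image_eqI[of _ _ i]) simp_all
    qed
    then show "finite ?S" by (rule finite_subset) simp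
  next
    assume fin: "finite ?S"
    obtain \<gamma> where \<gamma>: "\<gamma> \<in> carrier G" "val v c = Some \<gamma>" using val_nonzero[OF c(2)] .
    have "\<gamma> \<in> ?S" using S_iff[OF c(2) \<gamma>(2,1)] c val_ring_1[OF val_ring_R] by simp
    then have ne: "?S \<noteq> {}" by blast
    have "\<exists>l\<in>?S. \<forall>x\<in>?S. x \<noteq> l \<longrightarrow> gle G l x"
    proof (rule Finite_Set.bex_least_element[OF fin ne])
      show "transp_on ?S (gle G)" by (rule transp_onI) (use gle_trans in blast)
      show "totalp_on ?S (gle G)" by (rule totalp_onI) (use gle_total in blast)
    qed
    then obtain l where lS: "l \<in> ?S" and least: "\<forall>x\<in>?S. x \<noteq> l \<longrightarrow> gle G l x" by (rule bexE)
    have "gle G l x" if "x \<in> ?S" for x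
    proof (cases "x = l")
      case True
      then show ?thesis using lS gle_refl by simp
    qed (use least that in blast)
    note l = lS this
    obtain \<pi> where \<pi>: "\<pi> \<noteq> 0" "val v \<pi> = Some l" "\<pi> \<in> nonunits R" "c / \<pi> \<in> R" using S_ex[OF l(1)] by blast
    \<comment> \<open>Either \<open>a\<close> is divisible by \<open>c\<close>, which is divisible
      by \<open>\<pi>\<close>, or \<open>a\<close> divides \<open>c\<close>, so its value lies in
      the interval and is at least \<open>l\<close>.\<close>
    have "a / \<pi> \<in> R" if a: "a \<in> nonunits R" for a
    proof (cases "a = 0 \<or> a / c \<in> R")
      case True
      then show ?thesis
        using val_ring_mult[OF val_ring_R \<pi>(4), of "a / c"] c val_ring_0[OF val_ring_R] by auto
    next
      case False
      then have "c / a \<in> R" using val_ring_inverse[OF val_ring_R, of "a / c"] by simp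
      moreover obtain \<alpha> where \<alpha>: "\<alpha> \<in> carrier G" "val v a = Some \<alpha>" using val_nonzero False by blast
      ultimately have "gle G l \<alpha>" using S_iff[of a \<alpha>] False a l(2) by blast
      then show ?thesis using ext_le_val[OF \<pi>(1), of a] \<pi> \<alpha> by simp
    qed
    then have u: "uniformizing R \<pi>" using \<pi> by (simp add: uniformizing_def)
    have "\<exists>k. c / \<pi> ^ k \<notin> R"
    proof (rule ccontr)
      assume "\<nexists>k. c / \<pi> ^ k \<notin> R"
      then have all: "c / \<pi> ^ k \<in> R" for k by blast
      define g where "g k = the (val v (\<pi> ^ Suc k))" for k
      have lc: "l \<in> carrier G" using l by simp
      have g: "val v (\<pi> ^ Suc k) = Some (g k)" "g k \<in> carrier G" for k
        using val_power[OF \<pi>(2) lc, of "Suc k"] lc by (simp_all add: g_def del: power_Suc nat_pow_Suc)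
      have "g k \<in> ?S" for k
        using S_iff[OF _ g(1)[of k] g(2)] \<pi>(1) all[of "Suc k"] nonunits_power[OF val_ring_R \<pi>(3), of "Suc k"] by simp
      then have "range g \<subseteq> ?S" by (rule image_subsetI)
      then have "finite (range g)" using fin by (rule finite_subset)
      moreover have "inj g"
      proof (rule linorder_injI)
        fix i j :: nat assume ij: "i < j"
        show "g i \<noteq> g j"
        proof
          assume "g i = g j"
          then have "\<pi> ^ Suc i / \<pi> ^ Suc j \<in> R" using g(1)[of i] g(1)[of j] val_eq_iff[of "\<pi> ^ Suc i" "\<pi> ^ Suc j"] \<pi>(1) by simp
          moreover have "\<pi> ^ Suc i / \<pi> ^ Suc j = inverse (\<pi> ^ (j - i))"
            using ij \<pi>(1) by (simp add: power_diff divide_simps)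
          ultimately show False using uniformizing_power_unit[OF val_ring_R u] ij by fastforce
        qed
      qed
      ultimately show False using finite_imageD by blast
    qed
    then obtain k where "c / \<pi> ^ k \<notin> R" by blast
    then have "\<pi> ^ k / c \<in> R" using val_ring_inverse[OF val_ring_R] by fastforce
    then show ?rhs
      using uniformizing_below_power[OF val_ring_R u c(2) nonunits_subset[OF c(1)]] u by blast
  qed
qed

text \<open>The interval reaches up to the value of \<open>p\<close>, a nonzero nonunit, so
  \<open>finite_below_iff\<close> applies. What results depends on the valuation ring only, so
  p-valuations can be recognised from their rings.\<close>

lemma p_valuation_iff:
  fixes v :: "('a::field_char_0, 'g) valuation"
  assumes kv: "krull_valuation v"
  defines "R \<equiv> valuation_ring v"
  shows "p_valuation p v \<longleftrightarrow> Factorial_Ring.prime p \<and> finite (carrier (residue_field v)) \<and>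
    (\<forall>m. of_nat m \<in> nonunits R \<longleftrightarrow> p dvd m) \<and>
    (\<exists>\<pi> m. uniformizing R \<pi> \<and> of_nat p / \<pi> ^ m \<in> R \<and> \<pi> ^ m / of_nat p \<in> R)"
proof -
  interpret krull v "value_group v" by unfold_locales (rule kv)
  interpret V: val_ring_locale R unfolding R_def by unfold_locales (rule val_ring_R)
  have "has_characteristic (residue_field v) p \<longleftrightarrow> (\<forall>m. of_nat m \<in> nonunits R \<longleftrightarrow> p dvd m)"
    using V.has_characteristic_iff by (simp add: residue_field_eq R_def)
  moreover have "finite {\<gamma> \<in> carrier (value_group v).
               ext_less (value_group v) (Some \<one>\<^bsub>value_group v\<^esub>) (Some \<gamma>) \<and>
               ext_le (value_group v) (Some \<gamma>) (val v (of_nat p))} \<longleftrightarrow>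
    (\<exists>\<pi> m. uniformizing R \<pi> \<and> of_nat p / \<pi> ^ m \<in> R \<and> \<pi> ^ m / of_nat p \<in> R)"
    if "Factorial_Ring.prime p" "\<forall>m. of_nat m \<in> nonunits R \<longleftrightarrow> p dvd m"
    unfolding R_def by (rule finite_below_iff) (use that in \<open>auto simp: R_def\<close>)
  ultimately show ?thesis unfolding p_valuation_def using kv by blast
qed

section \<open>Primes and their valuation rings\<close>

definition ring_at :: "'a::field_char_0 prime \<Rightarrow> 'a set" where
  "ring_at P = valuation_ring (prime_val P)"

lemma p_valuation_krull: "p_valuation p v \<Longrightarrow> krull_valuation v"
  by (simp add: p_valuation_def)

text \<open>Every member of a prime qualifies for the choice made in \<open>prime_val\<close>, so
  the chosen valuation does belong to the prime.\<close>

lemma p_valuation_int_embedding: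
  assumes "p_valuation p v"
  shows "\<exists>j. is_int_embedding (value_group v) j"
proof -
  interpret krull v "value_group v" by unfold_locales (rule p_valuation_krull[OF assms])
  obtain \<pi> where "uniformizing (valuation_ring v) \<pi>"
    using p_valuation_iff[OF krull] assms by blast
  then show ?thesis using int_embedding_eq(1) by blast
qed

lemma prime_val_in:
  assumes "P \<in> primes"
  shows "prime_val P \<in> P" "P = {w \<in> p_valuations. val_equiv (prime_val P) w}" "prime_val P \<in> p_valuations"
proof -
  obtain v where v: "v \<in> p_valuations" "P = {w \<in> p_valuations. val_equiv v w}"
    using assms by (auto simp: primes_def quotient_def)
  have "\<exists>j. is_int_embedding (value_group v) j" "v \<in> P"
    using v p_valuation_int_embedding by (auto simp: p_valuations_def val_equiv_def)
  then show P: "prime_val P \<in> P" unfolding prime_val_def by (metis (mono_tags, lifting) someI_ex)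
  then show "P = {w \<in> p_valuations. val_equiv (prime_val P) w}" "prime_val P \<in> p_valuations"
    using v by (auto simp: val_equiv_def)
qed

lemma inj_on_ring_at: "inj_on ring_at primes"
proof (rule inj_onI)
  fix P Q :: "'a prime"
  assume PQ: "P \<in> primes" "Q \<in> primes" "ring_at P = ring_at Q"
  then show "P = Q"
    using prime_val_in(2)[OF PQ(1)] prime_val_in(2)[OF PQ(2)] by (simp add: ring_at_def val_equiv_def)
qed

lemma ex_prime_of_p_valuation:
  fixes v :: "('a::field_char_0, 'a set) valuation"
  assumes "p_valuation p v"
  obtains P where "P \<in> primes" "ring_at P = valuation_ring v"
proof -
  define P where "P = {w \<in> p_valuations. val_equiv v w}"
  have v: "v \<in> p_valuations" using assms by (auto simp: p_valuations_def)
  then have P: "P \<in> primes" unfolding primes_def P_def quotient_def by auto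
  then have "ring_at P = valuation_ring v"
    using prime_val_in(1)[OF P] by (simp add: P_def ring_at_def val_equiv_def)
  then show thesis using P that by blast
qed

lemma ext_le_carrier_update: "ext_le (G\<lparr>carrier := C\<rparr>) x y = ext_le G x y"
  by (cases x; cases y) simp_all

lemma lies_above_iff: "lies_above \<phi> P \<pp> \<longleftrightarrow> (\<forall>a. \<phi> a \<in> ring_at P \<longleftrightarrow> a \<in> ring_at \<pp>)"
proof -
  have "valuation_ring (restrict_val \<phi> (prime_val P)) = {a. \<phi> a \<in> ring_at P}"
    by (simp add: valuation_ring_def restrict_val_def ring_at_def ext_le_carrier_update)
  then show ?thesis by (auto simp: lies_above_def val_equiv_def ring_at_def)
qed

text \<open>Here \<open>c\<close> will be \<open>\<phi> t\<close>. Among the nonzero nonunits take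
  an \<open>a\<close> with a power \<open>a ^ k\<close> dividing \<open>c\<close> for the largest
  possible \<open>k\<close>. Maximality forces \<open>a\<close> to generate the maximal ideal and
  \<open>c\<close> to have the value of \<open>a ^ k\<close>, so a bound on exponents alone yields a
  least positive value.\<close>

lemma uniformizing_if_maximal_exponent:
  assumes R: "val_ring R" and c: "c \<in> nonunits R" "c \<noteq> 0"
    and bound: "\<And>a. a \<in> nonunits R \<Longrightarrow> a \<noteq> 0 \<Longrightarrow> c / a ^ Suc e \<notin> R"
  obtains \<pi> k where "uniformizing R \<pi>" "k \<le> e" "c / \<pi> ^ k \<in> R" "\<pi> ^ k / c \<in> R"
proof -
  define P where "P k \<longleftrightarrow> (\<exists>a\<in>nonunits R. a \<noteq> 0 \<and> c / a ^ k \<in> R)" for k :: nat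
  have P1: "P 1" using c val_ring_1[OF R] by (auto simp: P_def)
  have Pe: "k \<le> e" if "P k" for k
  proof (rule ccontr)
    assume k: "\<not> k \<le> e"
    from that obtain a where a: "a \<in> nonunits R" "a \<noteq> 0" "c / a ^ k \<in> R" by (auto simp: P_def)
    have "c / a ^ Suc e = c / a ^ k * a ^ (k - Suc e)"
      using k a(2) by (simp add: power_diff divide_simps)
    then show False
      using bound[OF a(1,2)] val_ring_mult[OF R a(3)] val_ring_power[OF R nonunits_subset[OF a(1)]] by metis
  qed
  \<comment> \<open>If \<open>a\<close> attains the maximal exponent and is a product of two nonunits, the smaller of the two doubles it.\<close>
  define k where "k = Greatest P"
  have k: "P k" "\<And>n. P n \<Longrightarrow> n \<le> k"
    unfolding k_def using GreatestI_nat[of P 1 e] Greatest_le_nat[of P _ e] P1 Pe by blast+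
  have k1: "k \<ge> 1" using k(2)[OF P1] .
  obtain a where a: "a \<in> nonunits R" "a \<noteq> 0" "c / a ^ k \<in> R" using k(1) by (auto simp: P_def)
  have "b / a \<in> R" if b: "b \<in> nonunits R" for b
  proof (rule ccontr)
    assume n: "b / a \<notin> R"
    then have b0: "b \<noteq> 0" using val_ring_0[OF R] by auto
    define d where "d = a / b"
    have d: "d \<in> nonunits R" "d \<noteq> 0" "a = b * d"
      using inverse_nonunit[OF R n] a b0 by (auto simp: d_def)
    have *: "P (2 * k)" if "x \<in> nonunits R" "x \<noteq> 0" "y / x \<in> R" "a = x * y" for x y
    proof -
      have "c / x ^ (2 * k) = c / a ^ k * (y / x) ^ k"
        using that a(2) by (simp add: power_mult_distrib power_mult power2_eq_square divide_simps)
      then have "c / x ^ (2 * k) \<in> R" using val_ring_mult[OF R a(3) val_ring_power[OF R that(3)]] by simp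
      then show ?thesis using that by (auto simp: P_def)
    qed
    have "P (2 * k)"
      using *[of b d] *[of d b] b b0 d val_ring_inverse[OF R, of "b / d"] by (auto simp: mult.commute)
    then show False using k(2)[of "2 * k"] k1 by simp
  qed
  then have u: "uniformizing R a" using a by (simp add: uniformizing_def)
  \<comment> \<open>Otherwise \<open>c / a ^ k\<close> is still a nonunit, hence divisible by
    \<open>a\<close>, and the exponent could be raised by one.\<close>
  have "a ^ k / c \<in> R"
  proof (rule ccontr)
    assume "a ^ k / c \<notin> R"
    then have "c / a ^ k \<in> nonunits R" using inverse_nonunit[OF R] by fastforce
    then have "c / a ^ k / a \<in> R" using u unfolding uniformizing_def by blast
    then have "P (Suc k)" using a by (auto simp: P_def mult.commute)
    then show False using k(2)[of "Suc k"] by simp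
  qed
  then show thesis using that[OF u Pe[OF k(1)] a(3)] by blast
qed

definition admissible ::
  "('k::field_char_0 \<Rightarrow> 'f::field_char_0) \<Rightarrow> 'k prime \<Rightarrow> 'k \<Rightarrow> nat \<Rightarrow> nat \<Rightarrow> 'f set \<Rightarrow> bool" where
  "admissible \<phi> \<pp> t e N R \<longleftrightarrow>
     val_ring R \<and> (\<forall>a. \<phi> a \<in> R \<longleftrightarrow> a \<in> ring_at \<pp>) \<and>
     (\<forall>a\<in>nonunits R. a \<noteq> 0 \<longrightarrow> \<phi> t / a ^ Suc e \<notin> R) \<and> residues_fixed N R"

context
  fixes \<phi> :: "'k::field_char_0 \<Rightarrow> 'f::field_char_0" and \<pp> :: "'k prime" and t :: 'k and e f :: nat
  assumes hom: "field_embedding \<phi>" and \<pp>: "\<pp> \<in> primes" and t: "uniformizer \<pp> t" and f: "f \<ge> 1"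
begin

definition residue_exponent :: nat where
  "residue_exponent = card (carrier (residue_field (prime_val \<pp>))) ^ f"

text \<open>Two uniformizing elements differ by a unit, so \<open>p\<close> is a unit times a power
  of the given \<open>t\<close> as well. This relation between \<open>p\<close> and \<open>t\<close>
  is preserved by \<open>\<phi>\<close> and later controls \<open>p\<close> in the larger
  field.\<close>

lemma base_prime:
  obtains p m where "p_valuation p (prime_val \<pp>)" "val_ring (ring_at \<pp>)" "uniformizing (ring_at \<pp>) t"
    "of_nat p / t ^ m \<in> ring_at \<pp>" "t ^ m / of_nat p \<in> ring_at \<pp>"
proof -
  obtain p where p: "p_valuation p (prime_val \<pp>)" using prime_val_in(3)[OF \<pp>] by (auto simp: p_valuations_def)
  interpret krull "prime_val \<pp>" "value_group (prime_val \<pp>)" by unfold_locales (rule p_valuation_krull[OF p])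
  obtain \<pi> m where \<pi>: "uniformizing R \<pi>" "of_nat p / \<pi> ^ m \<in> R" "\<pi> ^ m / of_nat p \<in> R"
    and char: "\<And>m. of_nat m \<in> nonunits R \<longleftrightarrow> p dvd m" and pp: "Factorial_Ring.prime p"
    using p unfolding p_valuation_iff[OF krull] by blast
  have ut: "uniformizing R t"
    using uniformizing_if_int_embedding[OF int_embedding_eq(1)[OF \<pi>(1)]] t by (simp add: uniformizer_def)
  have p0: "of_nat p \<noteq> (0::'k)" using pp by auto
  have "t ^ m / of_nat p = (t / \<pi>) ^ m * (\<pi> ^ m / of_nat p)"
    using \<pi>(1) by (simp add: uniformizing_def power_divide)
  then have "t ^ m / of_nat p \<in> R"
    using val_ring_mult[OF val_ring_R val_ring_power[OF val_ring_R uniformizing_unique(2)[OF \<pi>(1) ut]] \<pi>(3)] by metis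
  then obtain i where "of_nat p / t ^ i \<in> R" "t ^ i / of_nat p \<in> R"
    using uniformizing_below_power[OF val_ring_R ut p0 nonunits_subset] char[of p] by auto
  then show thesis using that p ut val_ring_R unfolding ring_at_def by blast
qed

lemma residue_exponent_ge_2: "residue_exponent \<ge> 2"
proof -
  obtain p where p: "p_valuation p (prime_val \<pp>)" using base_prime by blast
  interpret krull "prime_val \<pp>" "value_group (prime_val \<pp>)" by unfold_locales (rule p_valuation_krull[OF p])
  interpret V: val_ring_locale R by unfold_locales (rule val_ring_R)
  have fin: "finite (carrier V.res)" using p by (simp add: p_valuation_def residue_field_eq)
  have sub: "{\<zero>\<^bsub>V.res\<^esub>, \<one>\<^bsub>V.res\<^esub>} \<subseteq> carrier V.res" by simp
  have "card (carrier V.res) \<ge> 2" using card_mono[OF fin sub] by simp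
  then have "2 ^ 1 \<le> card (carrier V.res) ^ f" using f power_mono[of 2 "card (carrier V.res)" f]
    power_increasing[of 1 f "2::nat"] by linarith
  then show ?thesis by (simp add: residue_exponent_def residue_field_eq)
qed

lemma residue_degree_dvd_iff:
  assumes P: "P \<in> primes" "lies_above \<phi> P \<pp>"
  shows "residue_degree \<phi> P \<pp> dvd f \<longleftrightarrow> residues_fixed residue_exponent (ring_at P)"
proof -
  obtain p where p: "p_valuation p (prime_val P)" using prime_val_in(3)[OF P(1)] by (auto simp: p_valuations_def)
  obtain p' where p': "p_valuation p' (prime_val \<pp>)" using prime_val_in(3)[OF \<pp>] by (auto simp: p_valuations_def)
  interpret P: krull "prime_val P" "value_group (prime_val P)" by unfold_locales (rule p_valuation_krull[OF p])
  interpret Q: krull "prime_val \<pp>" "value_group (prime_val \<pp>)" by unfold_locales (rule p_valuation_krull[OF p'])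
  interpret val_ring_extension Q.R P.R \<phi>
    by unfold_locales (use P.val_ring_R Q.val_ring_R hom P(2) in \<open>auto simp: lies_above_iff ring_at_def\<close>)
  have "finite (carrier V.res)" using p by (simp add: p_valuation_def P.residue_field_eq)
  then show ?thesis
    using residue_dim_dvd_iff[of f] f
    by (simp add: residue_degree_def residue_exponent_def P.residue_field_eq Q.residue_field_eq ring_at_def)
qed

lemma admissible_ring_at:
  assumes "P \<in> primes_of_type \<phi> \<pp> t (e, f)"
  shows "admissible \<phi> \<pp> t e residue_exponent (ring_at P)"
proof -
  have P: "P \<in> primes" "lies_above \<phi> P \<pp>" and deg: "residue_degree \<phi> P \<pp> dvd f"
    and le: "ext_le (value_group (prime_val P)) (val (prime_val P) (\<phi> t))
          (Some (int_embedding (value_group (prime_val P)) (int e)))"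
    using assms by (simp_all add: primes_of_type_def)
  obtain p where p: "p_valuation p (prime_val P)" using prime_val_in(3)[OF P(1)] by (auto simp: p_valuations_def)
  interpret krull "prime_val P" "value_group (prime_val P)" by unfold_locales (rule p_valuation_krull[OF p])
  obtain \<pi> where \<pi>: "uniformizing R \<pi>" using p p_valuation_iff[OF krull] by blast
  obtain "uniformizing (ring_at \<pp>) t" "val_ring (ring_at \<pp>)" using base_prime by blast
  then interpret val_ring_extension "ring_at \<pp>" R \<phi>
    by unfold_locales (use val_ring_R hom P(2) in \<open>auto simp: lies_above_iff ring_at_def\<close>)
  have t0: "\<phi> t \<noteq> 0" using \<open>uniformizing (ring_at \<pp>) t\<close> by (simp add: uniformizing_def \<phi>_eq_0_iff)
  have \<pi>t: "\<pi> ^ e / \<phi> t \<in> R" using le ext_le_val[OF t0, of "\<pi> ^ e"] int_embedding_eq(2)[OF \<pi>, of e] by simp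
  have "\<phi> t / a ^ Suc e \<notin> R" if a: "a \<in> nonunits R" "a \<noteq> 0" for a
  proof
    assume *: "\<phi> t / a ^ Suc e \<in> R"
    have "a / \<pi> \<in> R" using \<pi> a by (simp add: uniformizing_def)
    \<comment> \<open>If \<open>a ^ Suc e\<close> divided \<open>\<phi> t\<close>, so would
      \<open>\<pi> ^ Suc e\<close>, while \<open>\<phi> t\<close> divides \<open>\<pi> ^ e\<close>.
      The product of the quotients collapses to \<open>inverse \<pi>\<close>, which is not
      integral.\<close>
    then have "(\<pi> ^ e / \<phi> t) * (\<phi> t / a ^ Suc e) * (a / \<pi>) ^ Suc e \<in> R"
      using * \<pi>t by (intro val_ring_mult[OF val_ring_R] val_ring_power[OF val_ring_R])
    moreover have "(\<pi> ^ e / \<phi> t) * (\<phi> t / a ^ Suc e) * (a / \<pi>) ^ Suc e = inverse (\<pi> ^ 1)"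
      using t0 a \<pi> by (simp add: uniformizing_def power_divide divide_simps)
    ultimately show False using uniformizing_power_unit[OF val_ring_R \<pi>, of 1] by (simp only:) simp
  qed
  then show ?thesis
    using val_ring_R P(2) residue_degree_dvd_iff[OF P] deg by (auto simp: admissible_def lies_above_iff ring_at_def)
qed

text \<open>The p-valuation is rebuilt from the ring: the exponent bound gives a uniformizing
  \<open>\<pi>\<close> with \<open>\<phi> t\<close> of the value of \<open>\<pi> ^ k\<close>, the
  power identity gives a finite residue field, and the characteristic comes from the base, because
  \<open>\<phi>\<close> preserves and reflects nonunits.\<close>

lemma ex_prime_of_admissible:
  assumes "admissible \<phi> \<pp> t e residue_exponent R"
  shows "\<exists>P\<in>primes_of_type \<phi> \<pp> t (e, f). ring_at P = R"
proof -
  have R: "val_ring R" "\<And>a. \<phi> a \<in> R \<longleftrightarrow> a \<in> ring_at \<pp>" "residues_fixed residue_exponent R"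
    and bound: "\<And>a. a \<in> nonunits R \<Longrightarrow> a \<noteq> 0 \<Longrightarrow> \<phi> t / a ^ Suc e \<notin> R"
    using assms by (auto simp: admissible_def)
  obtain p m where p: "p_valuation p (prime_val \<pp>)" and rp: "val_ring (ring_at \<pp>)"
    and ut: "uniformizing (ring_at \<pp>) t" and pt: "of_nat p / t ^ m \<in> ring_at \<pp>" "t ^ m / of_nat p \<in> ring_at \<pp>"
    by (rule base_prime)
  interpret val_ring_extension "ring_at \<pp>" R \<phi>
    by unfold_locales (use R rp hom in auto)
  have t0: "\<phi> t \<noteq> 0" and tM: "\<phi> t \<in> nonunits R"
    using ut by (simp_all add: uniformizing_def \<phi>_eq_0_iff \<phi>_nonunits)
  obtain \<pi> k where \<pi>: "uniformizing R \<pi>" "k \<le> e" "\<phi> t / \<pi> ^ k \<in> R" "\<pi> ^ k / \<phi> t \<in> R"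
    using uniformizing_if_maximal_exponent[OF R(1) tM t0 bound] by blast
  have \<pi>0: "\<pi> \<noteq> 0" using \<pi> by (simp add: uniformizing_def)
  have "\<phi> (of_nat p / t ^ m) \<in> R" "\<phi> (t ^ m / of_nat p) \<in> R" using pt above by simp_all
  then have pt': "of_nat p / \<phi> t ^ m \<in> R" "\<phi> t ^ m / of_nat p \<in> R" by (simp_all add: \<phi>_divide \<phi>_power \<phi>_of_nat)
  \<comment> \<open>Up to units \<open>p\<close> is \<open>t ^ m\<close> in the base field and
    \<open>\<phi> t\<close> is \<open>\<pi> ^ k\<close>, so \<open>p\<close> is
    \<open>\<pi> ^ (k * m)\<close>.\<close>
  have "of_nat p / \<pi> ^ (k * m) = of_nat p / \<phi> t ^ m * (\<phi> t / \<pi> ^ k) ^ m"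
    "\<pi> ^ (k * m) / of_nat p = \<phi> t ^ m / of_nat p * (\<pi> ^ k / \<phi> t) ^ m"
    using t0 \<pi>0 by (simp_all add: power_mult power_divide)
  then have p\<pi>: "of_nat p / \<pi> ^ (k * m) \<in> R" "\<pi> ^ (k * m) / of_nat p \<in> R"
    using pt' \<pi> by (simp_all add: val_ring_mult[OF R(1)] val_ring_power[OF R(1)] del: times_divide_eq_left times_divide_eq_right)
  obtain v :: "('f, 'f set) valuation" where v: "krull_valuation v" "valuation_ring v = R"
    using ex_valuation_of_val_ring[OF R(1)] .
  interpret v: krull v "value_group v" by unfold_locales (rule v)
  have fin: "finite (carrier V.res)"
    using V.res.finite_carrier_if_pow_eq[OF residue_exponent_ge_2] R(3) V.residues_fixed_iff by blast
  have char: "of_nat i \<in> nonunits R \<longleftrightarrow> p dvd i" for i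
    using p p_valuation_iff[OF p_valuation_krull[OF p]] \<phi>_nonunits[of "of_nat i"]
    by (auto simp: \<phi>_of_nat ring_at_def)
  have "Factorial_Ring.prime p" using p by (simp add: p_valuation_def)
  then have "p_valuation p v"
    unfolding p_valuation_iff[OF v(1)] v(2) v.residue_field_eq
    using fin char p\<pi> \<pi>(1) by (intro conjI allI exI)
  then obtain P where P: "P \<in> primes" "ring_at P = R" using ex_prime_of_p_valuation v(2) by metis
  obtain p' where p': "p_valuation p' (prime_val P)" using prime_val_in(3)[OF P(1)] by (auto simp: p_valuations_def)
  interpret P: krull "prime_val P" "value_group (prime_val P)" by unfold_locales (rule p_valuation_krull[OF p'])
  have PR: "P.R = R" using P by (simp add: ring_at_def)
  have la: "lies_above \<phi> P \<pp>" using R(2) P(2) by (simp add: lies_above_iff)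
  have "\<pi> ^ e / \<phi> t = \<pi> ^ (e - k) * (\<pi> ^ k / \<phi> t)"
    using \<pi>(2) by (simp flip: power_add)
  also have "\<dots> \<in> R"
    using \<pi> by (intro val_ring_mult[OF R(1)] val_ring_power[OF R(1)]) (simp_all add: uniformizing_def nonunits_subset)
  finally have "ext_le (value_group (prime_val P)) (val (prime_val P) (\<phi> t))
      (Some (int_embedding (value_group (prime_val P)) (int e)))"
    using P.ext_le_val[OF t0, of "\<pi> ^ e"] P.int_embedding_eq(2)[of \<pi> e] \<pi>(1) PR by simp
  moreover have "residue_degree \<phi> P \<pp> dvd f" using residue_degree_dvd_iff[OF P(1) la] R(3) P(2) by simp
  ultimately show ?thesis using P la by (intro bexI[of _ P]) (auto simp: primes_of_type_def)
qed

end

section \<open>Compactness of the constructible topology\<close>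

text \<open>Subsets are given by their indicators, so this is a power of the discrete two-point
  space, compact by Tychonoff's theorem.\<close>

definition subset_topology :: "('a \<Rightarrow> bool) topology" where
  "subset_topology = product_topology (\<lambda>_. discrete_topology UNIV) UNIV"

lemma topspace_subset_topology [simp]: "topspace subset_topology = UNIV"
  by (simp add: subset_topology_def)

lemma compact_space_subset_topology: "compact_space subset_topology"
  unfolding subset_topology_def
  by (intro compact_space_product_topology[THEN iffD2] disjI2 ballI) (simp add: compact_space_discrete_topology)

text \<open>With \<open>closed_cond\<close> this forms a calculus that reads off closedness from the
  shape of a formula: Boolean combinations of membership statements are clopen, and universal
  quantification keeps conditions closed.\<close>

definition clopen_cond :: "(('a \<Rightarrow> bool) \<Rightarrow> bool) \<Rightarrow> bool" where
  "clopen_cond C \<longleftrightarrow> openin subset_topology {\<omega>. C \<omega>} \<and> closedin subset_topology {\<omega>. C \<omega>}"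

lemma clopen_cond_not: "clopen_cond C \<Longrightarrow> clopen_cond (\<lambda>\<omega>. \<not> C \<omega>)"
  using openin_diff[OF openin_topspace[of subset_topology], of "{\<omega>. C \<omega>}"]
    closedin_diff[OF closedin_topspace[of subset_topology], of "{\<omega>. C \<omega>}"]
  by (simp add: clopen_cond_def Collect_neg_eq Compl_eq_Diff_UNIV)

lemma clopen_cond_app: "clopen_cond (\<lambda>\<omega>. \<omega> a)"
proof -
  have cont: "continuous_map subset_topology (discrete_topology UNIV) (\<lambda>\<omega>. \<omega> a :: bool)"
    unfolding subset_topology_def by (rule continuous_map_product_projection) simp
  have "openin subset_topology {\<omega> \<in> topspace subset_topology. \<omega> a \<in> {True}}"
    by (rule openin_continuous_map_preimage[OF cont]) simp
  moreover have "closedin subset_topology {\<omega> \<in> topspace subset_topology. \<omega> a \<in> {True}}"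
    by (rule closedin_continuous_map_preimage[OF cont]) simp
  ultimately show ?thesis by (simp add: clopen_cond_def)
qed

lemma clopen_cond_const: "clopen_cond (\<lambda>\<omega>. b)"
  using openin_topspace[of "subset_topology :: ('a \<Rightarrow> bool) topology"]
    closedin_topspace[of "subset_topology :: ('a \<Rightarrow> bool) topology"]
  by (cases b) (simp_all add: clopen_cond_def)

lemma clopen_cond_conj: "clopen_cond C \<Longrightarrow> clopen_cond D \<Longrightarrow> clopen_cond (\<lambda>\<omega>. C \<omega> \<and> D \<omega>)"
  by (simp add: clopen_cond_def Collect_conj_eq openin_Int closedin_Int)

lemma clopen_cond_disj: "clopen_cond C \<Longrightarrow> clopen_cond D \<Longrightarrow> clopen_cond (\<lambda>\<omega>. C \<omega> \<or> D \<omega>)"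
  by (simp add: clopen_cond_def Collect_disj_eq openin_Un closedin_Un)

lemma clopen_cond_imp: "clopen_cond C \<Longrightarrow> clopen_cond D \<Longrightarrow> clopen_cond (\<lambda>\<omega>. C \<omega> \<longrightarrow> D \<omega>)"
  unfolding imp_conv_disj by (intro clopen_cond_disj clopen_cond_not)

lemma clopen_cond_iff: "clopen_cond C \<Longrightarrow> clopen_cond D \<Longrightarrow> clopen_cond (\<lambda>\<omega>. C \<omega> \<longleftrightarrow> D \<omega>)"
  unfolding iff_conv_conj_imp by (intro clopen_cond_conj clopen_cond_imp)

lemmas clopen_cond_intros = clopen_cond_conj clopen_cond_disj clopen_cond_imp clopen_cond_iff
  clopen_cond_not clopen_cond_app clopen_cond_const

definition closed_cond :: "(('a \<Rightarrow> bool) \<Rightarrow> bool) \<Rightarrow> bool" where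
  "closed_cond C \<longleftrightarrow> closedin subset_topology {\<omega>. C \<omega>}"

lemma closed_cond_clopen: "clopen_cond C \<Longrightarrow> closed_cond C"
  by (simp add: closed_cond_def clopen_cond_def)

lemma closed_cond_conj: "closed_cond C \<Longrightarrow> closed_cond D \<Longrightarrow> closed_cond (\<lambda>\<omega>. C \<omega> \<and> D \<omega>)"
  by (simp add: closed_cond_def Collect_conj_eq closedin_Int)

lemma closed_cond_imp:
  assumes "clopen_cond C" "closed_cond D"
  shows "closed_cond (\<lambda>\<omega>. C \<omega> \<longrightarrow> D \<omega>)"
  unfolding imp_conv_disj closed_cond_def Collect_disj_eq
  by (rule closedin_Un) (use assms clopen_cond_not in \<open>auto simp: closed_cond_def clopen_cond_def\<close>)

lemma closed_cond_all: "(\<And>a. closed_cond (C a)) \<Longrightarrow> closed_cond (\<lambda>\<omega>. \<forall>a. C a \<omega>)"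
proof -
  assume *: "\<And>a. closed_cond (C a)"
  have "closedin subset_topology (\<Inter>a. {\<omega>. C a \<omega>})"
    by (rule closedin_Inter) (use * in \<open>auto simp: closed_cond_def\<close>)
  moreover have "(\<Inter>a. {\<omega>. C a \<omega>}) = {\<omega>. \<forall>a. C a \<omega>}" by blast
  ultimately show ?thesis by (simp add: closed_cond_def)
qed

text \<open>Unfolded, the condition is built by conjunctions and universal quantifiers from Boolean
  combinations of memberships of explicit elements; membership in the base ring and equations count
  as constants.\<close>

lemma closed_cond_admissible: "closed_cond (\<lambda>\<omega>. admissible \<phi> \<pp> t e N {a. \<omega> a})"
  unfolding admissible_def val_ring_def residues_fixed_def nonunits_def Ball_def mem_Collect_eq
  by (intro closed_cond_conj closed_cond_all closed_cond_imp; (rule closed_cond_clopen)?;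
      intro clopen_cond_intros)

section \<open>The space of primes of bounded type\<close>

lemma val_ge0_at_iff: "val_ge0_at P a \<longleftrightarrow> a \<in> ring_at P"
  by (simp add: val_ge0_at_def ring_at_def valuation_ring_def)

lemma topspace_constructible: "topspace (constructible_topology \<phi> \<pp> t \<tau>) = primes_of_type \<phi> \<pp> t \<tau>"
  unfolding constructible_topology_def topology_generated_by_topspace by auto

lemma openin_constructible:
  "openin (constructible_topology \<phi> \<pp> t \<tau>) {P \<in> primes_of_type \<phi> \<pp> t \<tau>. a \<in> ring_at P}"
  "openin (constructible_topology \<phi> \<pp> t \<tau>) {P \<in> primes_of_type \<phi> \<pp> t \<tau>. a \<notin> ring_at P}"
  unfolding constructible_topology_def by (auto intro!: topology_generated_by_Basis simp: val_ge0_at_iff)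

lemma primes_of_type_subset: "primes_of_type \<phi> \<pp> t \<tau> \<subseteq> primes"
  by (auto simp: primes_of_type_def)

text \<open>The space is the image of the closed set \<open>C\<close> of admissible indicators under
  a continuous map \<open>g\<close>, the inverse of \<open>ring_at\<close>. Continuity is tested on
  the subbasis, where preimages are conditions on the membership of a single element.\<close>

lemma compact_space_constructible:
  assumes "field_embedding \<phi>" "\<pp> \<in> primes" "uniformizer \<pp> t" "f \<ge> 1"
  shows "compact_space (constructible_topology \<phi> \<pp> t (e, f))"
proof -
  let ?T = "constructible_topology \<phi> \<pp> t (e, f)" and ?S = "primes_of_type \<phi> \<pp> t (e, f)"
  let ?N = "residue_exponent \<pp> f"
  define C where "C = {\<omega>. admissible \<phi> \<pp> t e ?N {a. \<omega> a}}"
  define g where "g \<omega> = inv_into ?S ring_at {a. \<omega> a}" for \<omega>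
  have image: "ring_at ` ?S = {R. admissible \<phi> \<pp> t e ?N R}"
  proof (rule equalityI; rule subsetI)
    fix R assume "R \<in> ring_at ` ?S"
    then obtain P where P: "P \<in> ?S" and R: "R = ring_at P" by (rule imageE)
    show "R \<in> {R. admissible \<phi> \<pp> t e ?N R}"
      unfolding R mem_Collect_eq by (rule admissible_ring_at[OF assms P])
  next
    fix R assume "R \<in> {R. admissible \<phi> \<pp> t e ?N R}"
    then obtain P where "P \<in> ?S" "ring_at P = R"
      unfolding mem_Collect_eq by (rule ex_prime_of_admissible[OF assms, THEN bexE])
    then show "R \<in> ring_at ` ?S" by (intro image_eqI[of _ _ P]) simp_all
  qed
  have g: "g \<omega> \<in> ?S" "ring_at (g \<omega>) = {a. \<omega> a}" if "\<omega> \<in> C" for \<omega>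
  proof -
    have "{a. \<omega> a} \<in> ring_at ` ?S" unfolding image using that by (simp add: C_def)
    then show "g \<omega> \<in> ?S" "ring_at (g \<omega>) = {a. \<omega> a}"
      unfolding g_def by (rule inv_into_into, rule f_inv_into_f)
  qed
  have inj: "inj_on ring_at ?S" using inj_on_subset[OF inj_on_ring_at primes_of_type_subset] .
  have surj: "g ` C = ?S"
  proof
    show "g ` C \<subseteq> ?S" using g by blast
    show "?S \<subseteq> g ` C"
    proof
      fix P assume P: "P \<in> ?S"
      let ?\<omega> = "\<lambda>a. a \<in> ring_at P"
      have "?\<omega> \<in> C" using P admissible_ring_at[OF assms] by (simp add: C_def)
      moreover have "g ?\<omega> = P" using inv_into_f_f[OF inj P] by (simp add: g_def)
      ultimately show "P \<in> g ` C" by (metis imageI)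
    qed
  qed
  have "closedin subset_topology C"
    using closed_cond_admissible unfolding C_def closed_cond_def .
  then have comp: "compact_space (subtopology subset_topology C)"
    by (intro compact_space_subtopology closedin_compact_space compact_space_subset_topology)
  have "continuous_map (subtopology subset_topology C) ?T g"
    unfolding constructible_topology_def
  proof (rule continuous_on_generated_topo)
    show "g ` topspace (subtopology subset_topology C) \<subseteq>
      \<Union> (range (\<lambda>a. {P \<in> ?S. val_ge0_at P a}) \<union> range (\<lambda>a. {P \<in> ?S. \<not> val_ge0_at P a}))"
      using surj by auto
    fix U assume "U \<in> range (\<lambda>a. {P \<in> ?S. val_ge0_at P a}) \<union> range (\<lambda>a. {P \<in> ?S. \<not> val_ge0_at P a})"
    then obtain a where "U = {P \<in> ?S. a \<in> ring_at P} \<or> U = {P \<in> ?S. a \<notin> ring_at P}"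
      by (auto simp: val_ge0_at_iff)
    then have "g -` U \<inter> C = {\<omega>. \<omega> a} \<inter> C \<or> g -` U \<inter> C = {\<omega>. \<not> \<omega> a} \<inter> C"
      using g by auto
    moreover have "openin subset_topology {\<omega>. \<omega> a}" "openin subset_topology {\<omega>. \<not> \<omega> a}"
      using clopen_cond_app[of a] clopen_cond_not[OF clopen_cond_app[of a]] by (simp_all add: clopen_cond_def)
    ultimately show "openin (subtopology subset_topology C) (g -` U \<inter> topspace (subtopology subset_topology C))"
      unfolding openin_subtopology by auto
  qed
  then have "compactin ?T (g ` topspace (subtopology subset_topology C))"
    using comp image_compactin unfolding compact_space_def by blast
  then show ?thesis by (simp add: surj compact_space_def topspace_constructible)
qed

section \<open>Approximation at the primes of bounded type\<close>

theorem theorem5p1: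
  fixes \<phi> :: "'k::field_char_0 \<Rightarrow> 'f::field_char_0"
    and \<pp> :: "'k prime" and t :: 'k
    and e f n :: nat
    and S :: "nat \<Rightarrow> 'f prime set"
    and x z :: "nat \<Rightarrow> 'f"
  assumes "is_number_field TYPE('k)"
    and "field_embedding \<phi>"
    and "\<pp> \<in> primes"
    and "uniformizer \<pp> t"
    and "e \<ge> 1" and "f \<ge> 1"
    and "\<And>i. i \<in> {1..n} \<Longrightarrow> closedin (constructible_topology \<phi> \<pp> t (e, f)) (S i)"
    and "disjoint_family_on S {1..n}"
    and "\<And>i. i \<in> {1..n} \<Longrightarrow> z i \<noteq> 0"
    and "\<And>i j \<PP> \<QQ> (w :: ('f, 'f set) valuation).
           \<lbrakk>i \<in> {1..n}; j \<in> {1..n}; \<PP> \<in> S i; \<QQ> \<in> S j;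
            finest_common_coarsening w (prime_val \<PP>) (prime_val \<QQ>)\<rbrakk> \<Longrightarrow>
           ext_le (value_group w) (val w (z i)) (val w (x i - x j)) \<and>
           val w (z i) = val w (z j)"
  shows "\<exists>y. \<forall>i\<in>{1..n}. \<forall>\<QQ>\<in>S i.
           ext_less (value_group (prime_val \<QQ>)) (val (prime_val \<QQ>) (z i)) (val (prime_val \<QQ>) (y - x i))"
proof -
  note base = assms(2,3,4,6)
  let ?T = "constructible_topology \<phi> \<pp> t (e, f)"
  have krull: "krull_valuation (prime_val P)" if "P \<in> topspace ?T" for P
  proof -
    have "P \<in> primes" using that primes_of_type_subset unfolding topspace_constructible by blast
    then show ?thesis using prime_val_in(3) p_valuation_krull by (auto simp: p_valuations_def)
  qed
  interpret val_ring_space ?T ring_at "residue_exponent \<pp> f"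
  proof
    show "residue_exponent \<pp> f \<ge> 2" by (rule residue_exponent_ge_2[OF base])
    show "inj_on ring_at (topspace ?T)"
      unfolding topspace_constructible using inj_on_subset[OF inj_on_ring_at primes_of_type_subset] .
  qed (use admissible_ring_at[OF base] openin_constructible in
      \<open>auto simp: topspace_constructible admissible_def\<close>)
  have ST: "S i \<subseteq> topspace ?T" if "i \<in> {1..n}" for i using assms(7)[OF that] closedin_subset by blast
  have comp: "compactin ?T (S i)" if "i \<in> {1..n}" for i
    using closedin_compact_space[OF compact_space_constructible[OF base] assms(7)[OF that]] .
  have prod: "(x i - x j) / z j \<in> ring_prod (ring_at P) (ring_at Q)"
    if ij: "i \<in> {1..n}" "j \<in> {1..n}" and PQ: "P \<in> S i" "Q \<in> S j" for i j P Q
  proof -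
    have kPQ: "krull_valuation (prime_val Q)" "krull_valuation (prime_val P)" using krull ST ij PQ by blast+
    \<comment> \<open>The primes are taken in reversed order: the inequality in the hypothesis
      involves \<open>z\<close> at the first index, and \<open>z j\<close> is wanted. The change of
      sign and \<open>ring_prod_commute\<close> undo the reversal.\<close>
    obtain w where w: "finest_common_coarsening w (prime_val Q) (prime_val P)"
      "valuation_ring w = ring_prod (ring_at Q) (ring_at P)"
      using ex_finest_common_coarsening[OF kPQ] unfolding ring_at_def .
    interpret w: krull w "value_group w"
      by unfold_locales (use w(1) in \<open>simp add: finest_common_coarsening_def\<close>)
    have "ext_le (value_group w) (val w (z j)) (val w (x j - x i))"
      using assms(10)[OF ij(2,1) PQ(2,1) w(1)] by (rule conjunct1)
    then have "(x j - x i) / z j \<in> valuation_ring w" using w.ext_le_val[OF assms(9)[OF ij(2)]] by simp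
    then have "- ((x j - x i) / z j) \<in> valuation_ring w" by (rule val_ring_uminus[OF w.val_ring_R])
    moreover have "- ((x j - x i) / z j) = (x i - x j) / z j" by (simp add: minus_divide_left)
    moreover have "ring_prod (ring_at Q) (ring_at P) = ring_prod (ring_at P) (ring_at Q)"
      by (rule ring_prod_commute)
    ultimately show ?thesis using w(2) by simp
  qed
  obtain y where y: "\<And>i P. i \<in> {1..n} \<Longrightarrow> P \<in> S i \<Longrightarrow> (y - x i) / z i \<in> nonunits (ring_at P)"
    using approximation[of "{1..n}" S x z, OF finite_atLeastAtMost comp assms(8) prod] by blast
  show ?thesis
  proof (intro exI[of _ y] ballI)
    fix i Q assume i: "i \<in> {1..n}" and Q: "Q \<in> S i"
    interpret q: krull "prime_val Q" "value_group (prime_val Q)"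
      by unfold_locales (use krull ST i Q in blast)
    show "ext_less (value_group (prime_val Q)) (val (prime_val Q) (z i)) (val (prime_val Q) (y - x i))"
      using q.ext_less_val[OF assms(9)[OF i]] y[OF i Q] by (simp add: ring_at_def)
  qed
qed


end
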